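(* Let $K$ be a field of characteristic zero. (a) If $n=4$, $d\ge3$ and $$H=x_1^{d-3}\big(0,\;0,\;x_2(x_1x_3-x_2x_4),\;x_1(x_1x_3-x_2x_4)\big),$$ then $H$ is a homogeneous counterexample of degree $d$ to $(\mathrm{JC}^-)\Rightarrow(\mathrm{JC})$; that is, $F=x+H$ satisfies $(\mathrm{JC}^-)$ but not $(\mathrm{JC})$. (b) If $n=5$, $d\ge2$ and $$H=\big(0,\;0,\;x_2^{d-1}x_4,\;x_1^{d-1}x_3-x_2^{d-1}x_5,\;x_1^{d-1}x_4\big),$$ then $H$ is a homogeneous counterexample of degree $d$ to $(\mathrm{JC}^+)\Rightarrow( * )$; that is, $F=x+H$ satisfies $(\mathrm{JC}^+)$ but not $( * )$. (c) Furthermore, for each $d\ge3$ there exist an $n$ and a power linear $H$ of degree $d$ in dimension $n$ such that $x+H$ satisfies $(\mathrm{JC}^-)$ but not $(\mathrm{JC})$, and for each $d\ge2$ there exist an $n$ and a power linear $H$ of degree $d$ in dimension $n$ such that $x+H$ satisfies $(\mathrm{JC}^+)$ but not $( * )$.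
   Context: $x=(x_1,\dots,x_n)$, vectors are column vectors, $M^{\mathrm t}$ is the transpose, $e_i$ is the $i$-th standard basis vector, $\bar K$ is the algebraic closure of $K$, $\mathcal{J}F=(\partial F_i/\partial x_j)_{i,j}$ is the Jacobian matrix and $|_{x=v}$ denotes substitution. $H\in K[x]^n$ is (homogeneous) power linear of degree $d$ if $H=\sum_{i=1}^n(a_i^{\mathrm t}x)^de_i$ for some $a_i\in K^n$, i.e. every component is a $d$-th power of a linear form over $K$. For $F=x+H$ of degree $d$, the properties are: $(\mathrm{JC}^-)$: $F$ is invertible as a polynomial map. $(\mathrm{JC})$: $\det\big(\sum_{i=1}^{d-1}(\mathcal{J}F)|_{x=v_i}\big)\in\bar K^{*}$ for all $v_1,\dots,v_{d-1}\in\bar K^n$. $(\mathrm{JC}^+)$: $\det\big(\sum_{i=1}^{n}(\mathcal{J}F)|_{x=v_i}\big)\in\bar K^{*}$ for all $v_1,\dots,v_n\in\bar K^n$. $( * )$: for some $N\in\mathbb{N}$ there are $b_i,c_i\in K^n$ and $d_i\in\{1,\dots,d\}$ ($1\le i\le N$) with $c_j^{\mathrm t}b_i=0$ for all $1\le j\le i\le N$ and $H=\sum_{i=1}^N(c_i^{\mathrm t}x)^{d_i}b_i$. *)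

theory Defs
  imports
    "HOL-Library.Poly_Mapping"
    "HOL-Algebra.Algebraic_Closure_Type"
    "Jordan_Normal_Form.Determinant"
begin

(* An element of 'a mpoly is a polynomial in the variables x_0, x_1, ...: it maps an exponent
   vector (a finitely supported map from variable indices to exponents) to its coefficient.
   Variables are numbered from 0, as are vector and matrix indices. *)
type_synonym 'a mpoly = "(nat \<Rightarrow>\<^sub>0 nat) \<Rightarrow>\<^sub>0 'a"

definition pconst :: "'a::zero \<Rightarrow> 'a mpoly" where
  "pconst c = Poly_Mapping.single 0 c"

definition pvar :: "nat \<Rightarrow> 'a::comm_ring_1 mpoly" where
  "pvar i = Poly_Mapping.single (Poly_Mapping.single i 1) 1"

definition mon_degree :: "(nat \<Rightarrow>\<^sub>0 nat) \<Rightarrow> nat" where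
  "mon_degree m = (\<Sum>i\<in>Poly_Mapping.keys m. Poly_Mapping.lookup m i)"

(* Apply h to the coefficients and substitute v $ i for x_i; h and v may take values in any
   commutative ring, so this covers evaluation at points and composition. Meaningful only if the
   variables of p have indices below dim_vec v. *)
definition psubst :: "('a::zero \<Rightarrow> 'b::comm_ring_1) \<Rightarrow> 'b vec \<Rightarrow> 'a mpoly \<Rightarrow> 'b" where
  "psubst h v p = (\<Sum>m\<in>Poly_Mapping.keys p.
     h (Poly_Mapping.lookup p m) * (\<Prod>i\<in>Poly_Mapping.keys m. (v $ i) ^ Poly_Mapping.lookup m i))"

(* Subtraction of exponents truncates, but only in terms whose coefficient is zero. *)
definition pdiff :: "nat \<Rightarrow> 'a::comm_ring_1 mpoly \<Rightarrow> 'a mpoly" where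
  "pdiff i p = (\<Sum>m\<in>Poly_Mapping.keys p.
     Poly_Mapping.single (m - Poly_Mapping.single i 1)
       (of_nat (Poly_Mapping.lookup m i) * Poly_Mapping.lookup p m))"

(* K[x]^n with x = (x_0, ..., x_(n-1)) *)
definition poly_maps :: "nat \<Rightarrow> 'a::zero mpoly vec set" where
  "poly_maps n = {F \<in> carrier_vec n.
     \<forall>j<n. \<forall>m\<in>Poly_Mapping.keys (F $ j). Poly_Mapping.keys m \<subseteq> {..<n}}"

definition id_map :: "nat \<Rightarrow> 'a::comm_ring_1 mpoly vec" where
  "id_map n = vec n pvar"

definition compose_map :: "'a::comm_ring_1 mpoly vec \<Rightarrow> 'a mpoly vec \<Rightarrow> 'a mpoly vec" where
  "compose_map F G = map_vec (psubst pconst G) F"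

definition map_degree :: "'a::zero mpoly vec \<Rightarrow> nat" where
  "map_degree F = Max (insert 0
     (\<Union>j<dim_vec F. mon_degree ` Poly_Mapping.keys (F $ j)))"

definition homogeneous_map :: "nat \<Rightarrow> nat \<Rightarrow> 'a::zero mpoly vec \<Rightarrow> bool" where
  "homogeneous_map n d H \<longleftrightarrow> H \<in> poly_maps n \<and>
     (\<forall>j<n. \<forall>m\<in>Poly_Mapping.keys (H $ j). mon_degree m = d)"

definition lin_form :: "nat \<Rightarrow> 'a::comm_ring_1 vec \<Rightarrow> 'a mpoly" where
  "lin_form n c = map_vec pconst c \<bullet> id_map n"

definition power_linear :: "nat \<Rightarrow> nat \<Rightarrow> 'a::comm_ring_1 mpoly vec \<Rightarrow> bool" where
  "power_linear n d H \<longleftrightarrow>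
     (\<exists>a. (\<forall>i<n. a i \<in> carrier_vec n) \<and> H = vec n (\<lambda>i. lin_form n (a i) ^ d))"

definition jacobian :: "nat \<Rightarrow> 'a::comm_ring_1 mpoly vec \<Rightarrow> 'a mpoly mat" where
  "jacobian n F = mat n n (\<lambda>(i, j). pdiff j (F $ i))"

definition jacobian_at ::
    "nat \<Rightarrow> 'a::field mpoly vec \<Rightarrow> 'a alg_closure vec \<Rightarrow> 'a alg_closure mat" where
  "jacobian_at n F v = map_mat (psubst to_ac v) (jacobian n F)"

definition jacobian_sums_nonsingular :: "nat \<Rightarrow> nat \<Rightarrow> 'a::field mpoly vec \<Rightarrow> bool" where
  "jacobian_sums_nonsingular r n F \<longleftrightarrow>
     (\<forall>v. (\<forall>k\<in>{1..r}. v k \<in> carrier_vec n) \<longrightarrow>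
        det (mat n n (\<lambda>ij. \<Sum>k=1..r. jacobian_at n F (v k) $$ ij)) \<noteq> 0)"

definition JC_minus :: "nat \<Rightarrow> 'a::comm_ring_1 mpoly vec \<Rightarrow> bool" where
  "JC_minus n F \<longleftrightarrow>
     (\<exists>G\<in>poly_maps n. compose_map F G = id_map n \<and> compose_map G F = id_map n)"

(* The parameter d stands for the degree of F. *)
definition JC :: "nat \<Rightarrow> nat \<Rightarrow> 'a::field mpoly vec \<Rightarrow> bool" where
  "JC n d F \<longleftrightarrow> jacobian_sums_nonsingular (d - 1) n F"

definition JC_plus :: "nat \<Rightarrow> 'a::field mpoly vec \<Rightarrow> bool" where
  "JC_plus n F \<longleftrightarrow> jacobian_sums_nonsingular n n F"

(* The star property of the map x + H of degree d, stated in terms of H. *)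
definition star_property :: "nat \<Rightarrow> nat \<Rightarrow> 'a::comm_ring_1 mpoly vec \<Rightarrow> bool" where
  "star_property n d H \<longleftrightarrow>
     (\<exists>(N::nat) (b :: nat \<Rightarrow> 'a vec) (c :: nat \<Rightarrow> 'a vec) (e :: nat \<Rightarrow> nat).
        (\<forall>i\<in>{1..N}. b i \<in> carrier_vec n \<and> c i \<in> carrier_vec n \<and> e i \<in> {1..d}) \<and>
        (\<forall>i j. 1 \<le> j \<and> j \<le> i \<and> i \<le> N \<longrightarrow> c j \<bullet> b i = 0) \<and>
        H = vec n (\<lambda>k. \<Sum>i=1..N. lin_form n (c i) ^ e i * pconst (b i $ k)))"

end

theory Submission
  imports Defs
begin

text \<open>
  Substitution and evaluation are ring homomorphisms, and \<open>JC\<close> and \<open>JC_plus\<close> say that no nonzero \<open>w\<close>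
  satisfies \<open>r w + \<Sum>\<^sub>k D\<^sub>w H (v\<^sub>k) = 0\<close> with \<open>r\<close> points \<open>v\<^sub>k\<close>.

  (a) The form \<open>x\<^sub>1 x\<^sub>3 - x\<^sub>2 x\<^sub>4\<close> is invariant under \<open>x + H\<close>, so \<open>x - H\<close> is the inverse. The points
  with \<open>(x\<^sub>1, x\<^sub>2) = (1, 0), (1, u)\<close> and \<open>0\<close> otherwise give a singular sum when \<open>u\<^sup>2 = - (d - 1)\<^sup>2\<close>.

  (b) The Jacobian of \<open>H\<close> acts on the last three coordinates by a nilpotent matrix whose shape is preserved
  by sums. If \<open>H\<close> had the star property and \<open>c\<^sub>i\<close> annihilated \<open>u\<close> for all \<open>i < j\<close>, then \<open>c\<^sub>j\<close> would
  annihilate every increment \<open>H (x + u) - H x\<close>. As \<open>H (e\<^sub>1 + e\<^sub>3) - H e\<^sub>1 = e\<^sub>4\<close> and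
  \<open>H (e\<^sub>2 + e\<^sub>4) - H e\<^sub>2 = e\<^sub>3\<close> form a cycle, induction on \<open>j\<close> shows that all \<open>c\<^sub>j\<close> annihilate
  \<open>e\<^sub>3\<close> and \<open>e\<^sub>4\<close>, so these increments vanish.

  (c) In characteristic zero \<open>H x = B (C x)\<^sup>d\<close> with componentwise powers, and \<open>B\<close> can be taken
  surjective by adding zero rows to \<open>C\<close> and unit columns to \<open>B\<close>. The Gorni-Zampieri pairing replaces \<open>H\<close> by the power linear map
  \<open>X \<mapsto> (C B X)\<^sup>d\<close>, which \<open>X \<mapsto> B X\<close> intertwines with \<open>H\<close>: inverses, kernel vectors and cycles all transfer.
\<close>

subsection \<open>Substitution homomorphisms\<close>

text \<open>Updating at a key outside the support amounts to adding a monomial, so every finitely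
  supported map is a finite sum of monomials. Additive identities, in particular both product rules
  below, then need checking on monomials only.\<close>

lemma poly_mapping_single_plus_induct:
  assumes "\<And>m c. P (Poly_Mapping.single m c)" and "\<And>p q. P p \<Longrightarrow> P q \<Longrightarrow> P (p + q)"
  shows "P (p :: 'b \<Rightarrow>\<^sub>0 'a::comm_monoid_add)"
proof (induction p rule: update_induct)
  case const
  \<comment> \<open>Zero is the monomial with coefficient 0 at any key.\<close>
  show ?case using assms(1)[of undefined 0] by simp
next
  case (update f a b)
  have "Poly_Mapping.update a b f = Poly_Mapping.single a b + f"
    using update(1)
    by (intro poly_mapping_eqI) (auto simp: lookup_update lookup_add lookup_single in_keys_iff when_def)
  then show ?case using assms update by simp
qed

lemma single_eq_pconst_mult: "Poly_Mapping.single m c = pconst c * Poly_Mapping.single m (1 :: 'a::comm_ring_1)"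
  by (simp add: pconst_def mult_single)

definition mon_value :: "'b::comm_monoid_mult vec \<Rightarrow> (nat \<Rightarrow>\<^sub>0 nat) \<Rightarrow> 'b" where
  "mon_value v m = (\<Prod>i\<in>Poly_Mapping.keys m. (v $ i) ^ Poly_Mapping.lookup m i)"

text \<open>Indices outside the support contribute the factor 1. A common index set makes the
  monomials in a product comparable.\<close>

lemma mon_value_superset:
  assumes "finite A" and "Poly_Mapping.keys m \<subseteq> A"
  shows "mon_value v m = (\<Prod>i\<in>A. (v $ i) ^ Poly_Mapping.lookup m i)"
  unfolding mon_value_def using assms
  by (intro prod.mono_neutral_left) (auto simp: in_keys_iff)

lemma mon_value_0 [simp]: "mon_value v 0 = 1"
  by (simp add: mon_value_def)

lemma mon_value_add: "mon_value v (m + m') = mon_value v m * mon_value v m'"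
proof -
  let ?A = "Poly_Mapping.keys m \<union> Poly_Mapping.keys m'"
  have "Poly_Mapping.keys (m + m') \<subseteq> ?A"
    by (rule Poly_Mapping.keys_add)
  then have "mon_value v (m + m') = (\<Prod>i\<in>?A. (v $ i) ^ Poly_Mapping.lookup (m + m') i)"
    by (rule mon_value_superset[rotated]) simp
  also have "\<dots> = mon_value v m * mon_value v m'"
    by (simp add: lookup_add power_add prod.distrib mon_value_superset[of ?A])
  finally show ?thesis .
qed

lemma psubst_mon_value:
  "psubst h v p = (\<Sum>m\<in>Poly_Mapping.keys p. h (Poly_Mapping.lookup p m) * mon_value v m)"
  by (simp add: psubst_def mon_value_def)

lemma psubst_single:
  assumes "comm_ring_hom h"
  shows "psubst h v (Poly_Mapping.single m c) = h c * mon_value v m"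
proof -
  interpret comm_ring_hom h by fact
  show ?thesis by (simp add: psubst_mon_value)
qed

text \<open>Cancellation may shrink the support of a sum; this does no harm, since each summand is
  additive in the coefficient and vanishes at coefficient 0.\<close>

lemma psubst_add:
  assumes "comm_ring_hom h"
  shows "psubst h v (p + q) = psubst h v p + psubst h v q"
proof -
  interpret comm_ring_hom h by fact
  show ?thesis unfolding psubst_mon_value
    by (rule setsum_keys_plus_distrib) (auto simp: hom_distribs algebra_simps)
qed

lemma psubst_mult:
  assumes h: "comm_ring_hom h"
  shows "psubst h v (p * q) = psubst h v p * psubst h v q"
proof (induction p rule: poly_mapping_single_plus_induct)
  case (1 m c)
  show ?case
  proof (induction q rule: poly_mapping_single_plus_induct)
    case (1 m' c')
    interpret comm_ring_hom h by fact
    show ?case by (simp add: mult_single psubst_single[OF h] mon_value_add hom_distribs)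
  next
    case (2 p q)
    then show ?case by (simp add: psubst_add[OF h] algebra_simps)
  qed
next
  case (2 p q)
  then show ?case by (simp add: psubst_add[OF h] algebra_simps)
qed

lemma comm_ring_hom_psubst:
  assumes h: "comm_ring_hom h"
  shows "comm_ring_hom (psubst h v)"
proof -
  interpret comm_ring_hom h by fact
  have "psubst h v 1 = 1"
    using psubst_single[OF h, of v 0 1] by (simp add: hom_distribs)
  moreover have "psubst h v 0 = 0"
    by (simp add: psubst_def)
  ultimately show ?thesis
    by unfold_locales (simp_all add: psubst_add[OF h] psubst_mult[OF h])
qed

lemma psubst_pconst [simp]: "comm_ring_hom h \<Longrightarrow> psubst h v (pconst c) = h c"
  by (simp add: pconst_def psubst_single)

lemma psubst_pvar [simp]:
  assumes "comm_ring_hom h"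
  shows "psubst h v (pvar i) = v $ i"
proof -
  interpret comm_ring_hom h by fact
  show ?thesis by (simp add: pvar_def psubst_single[OF assms] mon_value_def)
qed

text \<open>Three coefficient maps occur: \<open>to_ac\<close> for Jacobians at points over the
  algebraic closure, the identity for values over the base ring, and \<open>pconst\<close> for
  composition of polynomial maps.\<close>

lemma comm_ring_hom_to_ac: "comm_ring_hom to_ac"
  by unfold_locales simp_all

lemma comm_ring_hom_id: "comm_ring_hom (\<lambda>x. x)"
  by unfold_locales simp_all

lemma comm_ring_hom_pconst: "comm_ring_hom (pconst :: 'a::comm_ring_1 \<Rightarrow> 'a mpoly)"
  by unfold_locales (simp_all add: pconst_def single_add mult_single)

lemma lin_form_sum:
  assumes "c \<in> carrier_vec n"
  shows "lin_form n c = (\<Sum>j<n. pconst (c $ j) * pvar j)"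
  using assms by (auto simp: lin_form_def id_map_def scalar_prod_def atLeast0LessThan intro!: sum.cong)

lemma psubst_lin_form:
  assumes h: "comm_ring_hom h" and c: "c \<in> carrier_vec n"
  shows "psubst h v (lin_form n c) = (\<Sum>j<n. h (c $ j) * v $ j)"
proof -
  interpret comm_ring_hom "psubst h v" by (rule comm_ring_hom_psubst[OF h])
  show ?thesis by (simp add: lin_form_sum[OF c] hom_distribs h)
qed

subsection \<open>Polynomials in the first variables\<close>

definition poly_in :: "nat \<Rightarrow> 'a::zero mpoly \<Rightarrow> bool" where
  "poly_in n p \<longleftrightarrow> (\<forall>m\<in>Poly_Mapping.keys p. Poly_Mapping.keys m \<subseteq> {..<n})"

definition homogeneous :: "nat \<Rightarrow> 'a::zero mpoly \<Rightarrow> bool" where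
  "homogeneous d p \<longleftrightarrow> (\<forall>m\<in>Poly_Mapping.keys p. mon_degree m = d)"

lemma poly_maps_iff: "F \<in> poly_maps n \<longleftrightarrow> F \<in> carrier_vec n \<and> (\<forall>j<n. poly_in n (F $ j))"
  by (simp add: poly_maps_def poly_in_def)

lemma homogeneous_map_iff:
  "homogeneous_map n d H \<longleftrightarrow> H \<in> carrier_vec n \<and> (\<forall>j<n. poly_in n (H $ j) \<and> homogeneous d (H $ j))"
  by (auto simp: homogeneous_map_def poly_maps_iff homogeneous_def)

lemma mon_degree_superset:
  assumes "finite A" and "Poly_Mapping.keys m \<subseteq> A"
  shows "mon_degree m = (\<Sum>i\<in>A. Poly_Mapping.lookup m i)"
  unfolding mon_degree_def using assms
  by (intro sum.mono_neutral_left) (auto simp: in_keys_iff)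

lemma mon_degree_0 [simp]: "mon_degree 0 = 0"
  by (simp add: mon_degree_def)

lemma mon_degree_single [simp]: "mon_degree (Poly_Mapping.single i k) = k"
  by (simp add: mon_degree_def)

lemma mon_degree_add: "mon_degree (m + m') = mon_degree m + mon_degree m'"
proof -
  let ?A = "Poly_Mapping.keys m \<union> Poly_Mapping.keys m'"
  have "Poly_Mapping.keys (m + m') \<subseteq> ?A"
    by (rule Poly_Mapping.keys_add)
  then have "mon_degree (m + m') = (\<Sum>i\<in>?A. Poly_Mapping.lookup (m + m') i)"
    by (rule mon_degree_superset[rotated]) simp
  also have "\<dots> = mon_degree m + mon_degree m'"
    by (simp add: lookup_add sum.distrib mon_degree_superset[of ?A])
  finally show ?thesis .
qed

lemma poly_in_pconst [simp, intro]: "poly_in n (pconst c)"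
  by (simp add: poly_in_def pconst_def)

lemma poly_in_0 [simp, intro]: "poly_in n 0"
  by (simp add: poly_in_def)

lemma poly_in_1 [simp, intro]: "poly_in n (1 :: 'a::comm_ring_1 mpoly)"
  by (simp add: poly_in_def)

lemma poly_in_pvar [simp, intro]: "i < n \<Longrightarrow> poly_in n (pvar i)"
  by (simp add: poly_in_def pvar_def)

lemma poly_in_add [intro]: "poly_in n p \<Longrightarrow> poly_in n q \<Longrightarrow> poly_in n (p + q :: 'a::comm_ring_1 mpoly)"
  using Poly_Mapping.keys_add[of p q] unfolding poly_in_def by blast

lemma keys_diff_subset:
  "Poly_Mapping.keys (p - q :: 'b \<Rightarrow>\<^sub>0 'a::ab_group_add) \<subseteq> Poly_Mapping.keys p \<union> Poly_Mapping.keys q"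
  by (auto simp: in_keys_iff lookup_minus)

lemma poly_in_diff [intro]: "poly_in n p \<Longrightarrow> poly_in n q \<Longrightarrow> poly_in n (p - q :: 'a::comm_ring_1 mpoly)"
  using keys_diff_subset[of p q] unfolding poly_in_def by blast

lemma poly_in_mult [intro]:
  assumes "poly_in n p" and "poly_in n q"
  shows "poly_in n (p * q :: 'a::comm_ring_1 mpoly)"
  unfolding poly_in_def
proof
  fix m assume "m \<in> Poly_Mapping.keys (p * q)"
  then obtain a b where "m = a + b" "a \<in> Poly_Mapping.keys p" "b \<in> Poly_Mapping.keys q"
    using keys_mult[of p q] by blast
  then show "Poly_Mapping.keys m \<subseteq> {..<n}"
    using assms Poly_Mapping.keys_add[of a b] unfolding poly_in_def by blast
qed

lemma poly_in_power [intro]: "poly_in n p \<Longrightarrow> poly_in n (p ^ k :: 'a::comm_ring_1 mpoly)"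
  by (induction k) auto

lemma poly_in_sum [intro]:
  "(\<And>i. i \<in> I \<Longrightarrow> poly_in n (f i)) \<Longrightarrow> poly_in n (sum f I :: 'a::comm_ring_1 mpoly)"
  by (induction I rule: infinite_finite_induct) auto

lemma poly_in_prod [intro]:
  "(\<And>i. i \<in> I \<Longrightarrow> poly_in n (f i)) \<Longrightarrow> poly_in n (prod f I :: 'a::comm_ring_1 mpoly)"
  by (induction I rule: infinite_finite_induct) auto

lemma poly_in_lin_form: "c \<in> carrier_vec n \<Longrightarrow> poly_in n (lin_form n c)"
  by (auto simp: lin_form_sum)

lemma poly_in_psubst:
  fixes u :: "'a::comm_ring_1 mpoly vec"
  assumes "poly_in n p" and "\<And>i. i < n \<Longrightarrow> poly_in k (u $ i)"
  shows "poly_in k (psubst pconst u p)"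
  unfolding psubst_def using assms
  by (intro poly_in_sum poly_in_mult poly_in_prod poly_in_power) (auto simp: poly_in_def[of n])

lemma homogeneous_pconst [intro]: "homogeneous 0 (pconst c)"
  by (simp add: homogeneous_def pconst_def)

lemma homogeneous_0 [simp, intro]: "homogeneous d 0"
  by (simp add: homogeneous_def)

lemma homogeneous_1: "homogeneous 0 (1 :: 'a::comm_ring_1 mpoly)"
  by (simp add: homogeneous_def)

lemma homogeneous_pvar: "homogeneous (Suc 0) (pvar i)"
  by (simp add: homogeneous_def pvar_def)

lemma homogeneous_add [intro]:
  "homogeneous d p \<Longrightarrow> homogeneous d q \<Longrightarrow> homogeneous d (p + q :: 'a::comm_ring_1 mpoly)"
  using Poly_Mapping.keys_add[of p q] unfolding homogeneous_def by blast

lemma homogeneous_diff [intro]: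
  "homogeneous d p \<Longrightarrow> homogeneous d q \<Longrightarrow> homogeneous d (p - q :: 'a::comm_ring_1 mpoly)"
  using keys_diff_subset[of p q] unfolding homogeneous_def by blast

lemma homogeneous_mult:
  assumes "homogeneous d p" and "homogeneous e q"
  shows "homogeneous (d + e) (p * q :: 'a::comm_ring_1 mpoly)"
  unfolding homogeneous_def
proof
  fix m assume "m \<in> Poly_Mapping.keys (p * q)"
  then obtain a b where "m = a + b" "a \<in> Poly_Mapping.keys p" "b \<in> Poly_Mapping.keys q"
    using keys_mult[of p q] by blast
  then show "mon_degree m = d + e"
    using assms by (auto simp: homogeneous_def mon_degree_add)
qed

lemma homogeneous_power: "homogeneous d p \<Longrightarrow> homogeneous (k * d) (p ^ k :: 'a::comm_ring_1 mpoly)"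
  by (induction k) (auto intro: homogeneous_1 homogeneous_mult)

lemma homogeneous_sum [intro]:
  "(\<And>i. i \<in> I \<Longrightarrow> homogeneous d (f i)) \<Longrightarrow> homogeneous d (sum f I :: 'a::comm_ring_1 mpoly)"
  by (induction I rule: infinite_finite_induct) auto

lemma homogeneous_lin_form: "c \<in> carrier_vec n \<Longrightarrow> homogeneous (Suc 0) (lin_form n c)"
  unfolding lin_form_sum
  using homogeneous_mult[OF homogeneous_pconst homogeneous_pvar] by (intro homogeneous_sum) auto

text \<open>The identity contributes only monomials of degree 1, and since \<open>d \<ge> 2\<close>
  these cannot cancel a monomial of \<open>H\<close>.\<close>

lemma map_degree_id_plus_homogeneous:
  fixes H :: "'a::comm_ring_1 mpoly vec"
  assumes H: "homogeneous_map n d H" and d: "d \<ge> 2" and j: "j < n" "H $ j \<noteq> 0"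
  shows "map_degree (id_map n + H) = d"
proof -
  define D where "D = (\<Union>i<n. mon_degree ` Poly_Mapping.keys (pvar i + H $ i))"
  have H': "dim_vec H = n" "\<And>i m. i < n \<Longrightarrow> m \<in> Poly_Mapping.keys (H $ i) \<Longrightarrow> mon_degree m = d"
    using H by (auto simp: homogeneous_map_iff homogeneous_def)
  have D: "map_degree (id_map n + H) = Max (insert 0 D)"
    unfolding map_degree_def D_def
    using H'(1) by (intro arg_cong[where f = Max] arg_cong[where f = "insert 0"] SUP_cong) (simp_all add: id_map_def)
  have "k \<le> d" if "k \<in> D" for k
  proof -
    from that obtain i m where i: "i < n" "m \<in> Poly_Mapping.keys (pvar i + H $ i)" "k = mon_degree m"
      unfolding D_def by (elim UN_E imageE) simp
    then have "m \<in> Poly_Mapping.keys (pvar i :: 'a mpoly) \<or> m \<in> Poly_Mapping.keys (H $ i)"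
      using subsetD[OF Poly_Mapping.keys_add i(2)] by simp
    then show ?thesis
      using homogeneous_pvar[of i, where 'a = 'a] H'(2)[of i m] i d unfolding homogeneous_def by auto
  qed
  moreover have "d \<in> D"
  proof -
    have "\<exists>m. Poly_Mapping.lookup (H $ j) m \<noteq> 0"
      using j(2) by (metis poly_mapping_eqI lookup_zero)
    then obtain m where m: "m \<in> Poly_Mapping.keys (H $ j)"
      by (auto simp: in_keys_iff)
    then have deg: "mon_degree m = d" using H'(2) j(1) by blast
    with d have "m \<noteq> Poly_Mapping.single j 1" by auto
    then have "m \<in> Poly_Mapping.keys (pvar j + H $ j)"
      using m by (simp add: in_keys_iff lookup_add pvar_def lookup_single)
    then show ?thesis
      unfolding D_def deg[symmetric] using j(1) by (intro UN_I[of j] imageI) auto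
  qed
  moreover have "finite D"
    unfolding D_def by simp
  ultimately show ?thesis
    unfolding D by (intro Max_eqI) auto
qed

subsection \<open>Derivatives\<close>

lemma pdiff_single:
  "pdiff i (Poly_Mapping.single m c) =
    Poly_Mapping.single (m - Poly_Mapping.single i 1) (of_nat (Poly_Mapping.lookup m i) * c)"
  by (simp add: pdiff_def)

lemma pdiff_add: "pdiff i (p + q) = pdiff i p + pdiff i q"
  unfolding pdiff_def
  by (rule setsum_keys_plus_distrib) (auto simp: single_add[symmetric] algebra_simps)

lemma diff_single_add:
  "Poly_Mapping.lookup m i \<noteq> 0 \<Longrightarrow>
    m + m' - Poly_Mapping.single i 1 = (m - Poly_Mapping.single i 1) + (m' :: nat \<Rightarrow>\<^sub>0 nat)"
  by (rule poly_mapping_eqI) (auto simp: lookup_add lookup_minus lookup_single when_def)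

lemma pdiff_mult: "pdiff i (p * q) = pdiff i p * q + p * pdiff i q"
proof (induction p rule: poly_mapping_single_plus_induct)
  case (1 m c)
  show ?case
  proof (induction q rule: poly_mapping_single_plus_induct)
    case (1 m' c')
    let ?e = "Poly_Mapping.single i (1::nat)"
    \<comment> \<open>If the variable does not occur in \<open>m\<close>, truncation may make the
      exponents differ, but then both coefficients are zero.\<close>
    have A: "Poly_Mapping.single (m + m' - ?e) (of_nat (Poly_Mapping.lookup m i) * c * c') =
        Poly_Mapping.single (m - ?e + m') (of_nat (Poly_Mapping.lookup m i) * c * c')"
      using diff_single_add[of m i m']
      by (cases "Poly_Mapping.lookup m i = 0") auto
    have B: "Poly_Mapping.single (m + m' - ?e) (c * (of_nat (Poly_Mapping.lookup m' i) * c')) =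
        Poly_Mapping.single (m + (m' - ?e)) (c * (of_nat (Poly_Mapping.lookup m' i) * c'))"
      using diff_single_add[of m' i m]
      by (cases "Poly_Mapping.lookup m' i = 0") (auto simp: add.commute)
    show ?case
      unfolding mult_single pdiff_single A[symmetric] B[symmetric] single_add[symmetric]
      by (simp add: lookup_add algebra_simps)
  next
    case (2 p q)
    then show ?case by (simp add: pdiff_add algebra_simps)
  qed
next
  case (2 p q)
  then show ?case by (simp add: pdiff_add algebra_simps)
qed

lemma pdiff_pconst: "pdiff i (pconst c) = 0"
  by (simp add: pconst_def pdiff_single)

lemma pdiff_pvar: "pdiff i (pvar j) = pconst (if i = j then 1 else 0)"
  by (simp add: pvar_def pdiff_single pconst_def lookup_single)

text \<open>The gradient of \<open>p\<close> at \<open>v\<close>, paired with the direction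
  \<open>w\<close>; for a component of a map this is one entry of Jacobian times vector. It obeys
  the product rule, so kernels of Jacobian sums can be studied without expanding
  determinants.\<close>

definition dir_deriv ::
    "nat \<Rightarrow> ('a::comm_ring_1 \<Rightarrow> 'b::comm_ring_1) \<Rightarrow> 'b vec \<Rightarrow> 'b vec \<Rightarrow> 'a mpoly \<Rightarrow> 'b" where
  "dir_deriv n h v w p = (\<Sum>j<n. psubst h v (pdiff j p) * w $ j)"

context
  fixes h :: "'a::comm_ring_1 \<Rightarrow> 'b::comm_ring_1"
  assumes h: "comm_ring_hom h"
begin

interpretation comm_ring_hom h by (rule h)
interpretation subst: comm_ring_hom "psubst h v" for v by (rule comm_ring_hom_psubst[OF h])

lemma dir_deriv_pconst [simp]: "dir_deriv n h v w (pconst c) = 0"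
  by (simp add: dir_deriv_def pdiff_pconst)

lemma dir_deriv_pvar [simp]:
  assumes "i < n"
  shows "dir_deriv n h v w (pvar i) = w $ i"
proof -
  have "dir_deriv n h v w (pvar i) = (\<Sum>j<n. if j = i then w $ j else 0)"
    unfolding dir_deriv_def by (intro sum.cong) (auto simp: pdiff_pvar h)
  with assms show ?thesis by simp
qed

lemma dir_deriv_add [simp]: "dir_deriv n h v w (p + q) = dir_deriv n h v w p + dir_deriv n h v w q"
  by (simp add: dir_deriv_def pdiff_add hom_distribs algebra_simps sum.distrib)

lemma dir_deriv_mult [simp]:
  "dir_deriv n h v w (p * q) = dir_deriv n h v w p * psubst h v q + psubst h v p * dir_deriv n h v w q"
  by (simp add: dir_deriv_def pdiff_mult hom_distribs sum_distrib_left sum_distrib_right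
      sum.distrib[symmetric] algebra_simps)

lemma dir_deriv_0 [simp]: "dir_deriv n h v w 0 = 0"
  using dir_deriv_pconst[of n v w 0] by (simp add: pconst_def)

lemma dir_deriv_1 [simp]: "dir_deriv n h v w 1 = 0"
  using dir_deriv_pconst[of n v w 1] by (simp add: pconst_def)

lemma dir_deriv_diff [simp]: "dir_deriv n h v w (p - q) = dir_deriv n h v w p - dir_deriv n h v w q"
  using dir_deriv_add[of n v w "p - q" q] by (simp del: dir_deriv_add)

lemma dir_deriv_sum: "dir_deriv n h v w (sum f I) = (\<Sum>i\<in>I. dir_deriv n h v w (f i))"
  by (induction I rule: infinite_finite_induct) auto

text \<open>For \<open>k = 0\<close> the truncated exponent is harmless because the factor
  \<open>of_nat k\<close> vanishes.\<close>

lemma dir_deriv_power: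
  "dir_deriv n h v w (p ^ k) = of_nat k * psubst h v p ^ (k - 1) * dir_deriv n h v w p"
proof (induction k)
  case (Suc k)
  then show ?case by (cases k) (simp_all add: hom_distribs algebra_simps)
qed simp

lemma dir_deriv_lin_form:
  assumes "c \<in> carrier_vec n"
  shows "dir_deriv n h v w (lin_form n c) = (\<Sum>j<n. h (c $ j) * w $ j)"
  by (simp add: lin_form_sum[OF assms] dir_deriv_sum h)

end

text \<open>Over a field a nonzero determinant means a trivial kernel. The identity part of the map
  contributes \<open>w\<close> once for each of the \<open>r\<close> points.\<close>

lemma jacobian_sums_nonsingular_iff_kernel:
  assumes H: "H \<in> carrier_vec n"
  shows "jacobian_sums_nonsingular r n (id_map n + H) \<longleftrightarrow>
    (\<forall>v. (\<forall>k\<in>{1..r}. v k \<in> carrier_vec n) \<longrightarrow> (\<forall>w\<in>carrier_vec n.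
      (\<forall>i<n. of_nat r * w $ i + (\<Sum>k=1..r. dir_deriv n to_ac (v k) w (H $ i)) = 0) \<longrightarrow> w = 0\<^sub>v n))"
proof -
  have "det (mat n n (\<lambda>ij. \<Sum>k=1..r. jacobian_at n (id_map n + H) (v k) $$ ij)) \<noteq> 0 \<longleftrightarrow>
     (\<forall>w\<in>carrier_vec n.
      (\<forall>i<n. of_nat r * w $ i + (\<Sum>k=1..r. dir_deriv n to_ac (v k) w (H $ i)) = 0) \<longrightarrow> w = 0\<^sub>v n)"
    (is "det ?M \<noteq> 0 \<longleftrightarrow> _") for v
  proof -
    have entry: "(?M *\<^sub>v w) $ i = of_nat r * w $ i + (\<Sum>k=1..r. dir_deriv n to_ac (v k) w (H $ i))"
      if w: "w \<in> carrier_vec n" and i: "i < n" for w i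
    proof -
      have "(?M *\<^sub>v w) $ i = (\<Sum>j<n. (\<Sum>k=1..r. psubst to_ac (v k) (pdiff j (pvar i + H $ i))) * w $ j)"
        using w i H
        by (auto simp: scalar_prod_def atLeast0LessThan jacobian_at_def jacobian_def id_map_def intro!: sum.cong)
      also have "\<dots> = (\<Sum>k=1..r. dir_deriv n to_ac (v k) w (pvar i + H $ i))"
        unfolding dir_deriv_def sum_distrib_right by (rule sum.swap)
      also have "\<dots> = of_nat r * w $ i + (\<Sum>k=1..r. dir_deriv n to_ac (v k) w (H $ i))"
        using i by (simp add: comm_ring_hom_to_ac sum.distrib)
      finally show ?thesis .
    qed
    have "?M *\<^sub>v w = 0\<^sub>v n \<longleftrightarrow>
        (\<forall>i<n. of_nat r * w $ i + (\<Sum>k=1..r. dir_deriv n to_ac (v k) w (H $ i)) = 0)"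
      if "w \<in> carrier_vec n" for w
      using entry[OF that] by (auto simp: vec_eq_iff)
    then show ?thesis
      using det_0_iff_vec_prod_zero_field[of ?M n] by auto
  qed
  then show ?thesis unfolding jacobian_sums_nonsingular_def by blast
qed

subsection \<open>Sums of powers of linear forms\<close>

text \<open>The linear span of the \<open>d\<close>-th powers of linear forms. The aim is to show
  that it contains every form of degree \<open>d\<close>.\<close>

definition power_sums :: "nat \<Rightarrow> nat \<Rightarrow> 'a::comm_ring_1 mpoly set" where
  "power_sums n d = {p. \<exists>N a c. (\<forall>i<N. c i \<in> carrier_vec n) \<and>
     p = (\<Sum>i<N::nat. lin_form n (c i) ^ d * pconst (a i))}"

lemma power_sumsI:
  "(\<And>i. i < N \<Longrightarrow> c i \<in> carrier_vec n) \<Longrightarrow> p = (\<Sum>i<N::nat. lin_form n (c i) ^ d * pconst (a i)) \<Longrightarrow>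
    p \<in> power_sums n d"
  unfolding power_sums_def mem_Collect_eq by (intro exI conjI) auto

lemma power_sumsE:
  assumes "p \<in> power_sums n d"
  obtains N a c where "\<forall>i<N. c i \<in> carrier_vec n"
    "p = (\<Sum>i<N::nat. lin_form n (c i) ^ d * pconst (a i))"
  using assms unfolding power_sums_def mem_Collect_eq by (elim exE conjE) (rule that)

lemma power_sums_0: "0 \<in> power_sums n d"
  by (rule power_sumsI[of 0]) auto

lemma power_sums_power: "c \<in> carrier_vec n \<Longrightarrow> lin_form n c ^ d \<in> power_sums n d"
  by (rule power_sumsI[of 1 "\<lambda>_. c" _ _ _ "\<lambda>_. 1"]) (auto simp: pconst_def)

text \<open>Index bookkeeping for concatenating two finite families, used to add power sums and
  later to pad one with zero summands.\<close>

lemma sum_lessThan_append: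
  "(\<Sum>i<M + N. if i < M then f i else g (i - M)) = (\<Sum>i<M. f i) + (\<Sum>i<N::nat. g i :: 'a::comm_monoid_add)"
  by (induction N) (simp_all add: add.assoc)

lemma power_sums_add:
  assumes "p \<in> power_sums n d" and "q \<in> power_sums n d"
  shows "p + q \<in> power_sums n d"
proof -
  obtain M a c where M: "\<forall>i<M. c i \<in> carrier_vec n"
    "p = (\<Sum>i<M::nat. lin_form n (c i) ^ d * pconst (a i))"
    using assms(1) by (rule power_sumsE)
  obtain N a' c' where N: "\<forall>i<N. c' i \<in> carrier_vec n"
    "q = (\<Sum>i<N::nat. lin_form n (c' i) ^ d * pconst (a' i))"
    using assms(2) by (rule power_sumsE)
  let ?c = "\<lambda>i. if i < M then c i else c' (i - M)"
  let ?a = "\<lambda>i. if i < M then a i else a' (i - M)"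
  show ?thesis
  proof (rule power_sumsI[of "M + N" ?c])
    show "p + q = (\<Sum>i<M + N. lin_form n (?c i) ^ d * pconst (?a i))"
      unfolding M(2) N(2) sum_lessThan_append[symmetric] by (intro sum.cong) auto
  qed (use M N in auto)
qed

lemma power_sums_scale:
  assumes "p \<in> power_sums n d"
  shows "pconst a * p \<in> power_sums n d"
proof -
  obtain N b c where N: "\<forall>i<N. c i \<in> carrier_vec n"
    "p = (\<Sum>i<N::nat. lin_form n (c i) ^ d * pconst (b i))"
    using assms(1) by (rule power_sumsE)
  interpret pc: comm_ring_hom "pconst :: 'a \<Rightarrow> 'a mpoly" by (rule comm_ring_hom_pconst)
  show ?thesis
  proof (rule power_sumsI[of N c])
    show "pconst a * p = (\<Sum>i<N. lin_form n (c i) ^ d * pconst (a * b i))"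
      unfolding N(2) sum_distrib_left
      by (intro sum.cong refl) (simp add: pc.hom_mult ac_simps)
  qed (use N in auto)
qed

text \<open>A Vandermonde argument: \<open>p (2 t) - 2 ^ d * p t\<close> has degree less than \<open>d\<close>.\<close>
lemma polynomial_values_imp_coeffs:
  fixes f :: "nat \<Rightarrow> 'a::field_char_0 mpoly"
  assumes add: "\<And>p q. p \<in> W \<Longrightarrow> q \<in> W \<Longrightarrow> p + q \<in> W"
    and scale: "\<And>a p. p \<in> W \<Longrightarrow> pconst a * p \<in> W"
    and val: "\<And>t. (\<Sum>k\<le>d. pconst (t ^ k) * f k) \<in> W" and k: "k \<le> d"
  shows "f k \<in> W"
  using val k
proof (induction d arbitrary: f k)
  case 0
  then show ?case by (simp add: pconst_def)
next
  case (Suc d)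
  interpret pc: comm_ring_hom "pconst :: 'a \<Rightarrow> 'a mpoly" by (rule comm_ring_hom_pconst)
  have unscale: "p \<in> W" if "pconst a * p \<in> W" "a \<noteq> 0" for a p
    using scale[OF that(1), of "inverse a"] that(2)
    by (simp flip: mult.assoc pc.hom_mult)
  have low: "f k \<in> W" if "k \<le> d" for k
  proof -
    have "pconst (2 ^ k - 2 ^ Suc d) * f k \<in> W"
    proof (rule Suc.IH)
      fix t :: 'a
      let ?s = "\<lambda>t. \<Sum>k\<le>Suc d. pconst (t ^ k) * f k"
      have "?s (2 * t) + pconst (- (2 ^ Suc d)) * ?s t =
          (\<Sum>k\<le>Suc d. pconst (t ^ k) * (pconst (2 ^ k - 2 ^ Suc d) * f k))"
        by (simp only: sum_distrib_left sum.distrib[symmetric])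
          (intro sum.cong refl, simp add: power_mult_distrib pc.hom_mult pc.hom_minus pc.hom_uminus algebra_simps)
      also have "\<dots> = (\<Sum>k\<le>d. pconst (t ^ k) * (pconst (2 ^ k - 2 ^ Suc d) * f k))"
        by simp
      finally show "(\<Sum>k\<le>d. pconst (t ^ k) * (pconst (2 ^ k - 2 ^ Suc d) * f k)) \<in> W"
        using add[OF Suc.prems(1)[of "2 * t"] scale[OF Suc.prems(1)[of t], of "- (2 ^ Suc d)"]] by (simp only:)
    qed (rule that)
    \<comment> \<open>Characteristic zero keeps the powers of 2 distinct, so the factor in front of
      \<open>f k\<close> can be divided out.\<close>
    moreover have "(2::'a) ^ k \<noteq> 2 ^ Suc d"
    proof -
      have "(2::nat) ^ k \<noteq> 2 ^ Suc d" using that by (subst power_inject_exp) auto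
      then have "of_nat (2 ^ k) \<noteq> (of_nat (2 ^ Suc d) :: 'a)" unfolding of_nat_eq_iff .
      then show ?thesis by simp
    qed
    ultimately show ?thesis
      using unscale[of "2 ^ k - 2 ^ Suc d" "f k"] by (simp only: right_minus_eq simp_thms)
  qed
  show ?case
  proof (cases "k \<le> d")
    case True
    then show ?thesis by (rule low)
  next
    case False
    \<comment> \<open>The top coefficient is the value at \<open>t = 1\<close> minus all lower
      coefficients. The partial sums start with one term because \<open>0 \<in> W\<close> is not
      among the assumptions.\<close>
    have "sum f {..<m} \<in> W" if "m \<le> Suc d" "m > 0" for m
      using that
    proof (induction m)
      case (Suc m)
      have "f m \<in> W" using Suc.prems by (intro low) simp
      then show ?case using Suc.IH Suc.prems by (cases "m = 0") (simp_all add: add)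
    qed simp
    from scale[OF this[of "Suc d"], of "- 1"] have "- sum f {..<Suc d} \<in> W"
      by (simp add: pc.hom_uminus)
    moreover have "sum f {..Suc d} \<in> W"
      using Suc.prems(1)[of 1] by simp
    ultimately have "sum f {..Suc d} + - sum f {..<Suc d} \<in> W"
      by (intro add)
    then show ?thesis
      using False Suc.prems(2) by (simp add: lessThan_Suc_atMost le_Suc_eq)
  qed
qed

text \<open>Polarization, absorbing one factor at a time. By induction
  \<open>(u + t c) ^ (k + 1)\<close> times the remaining forms is a power sum for every
  \<open>t\<close>, hence so is its coefficient at \<open>t\<close>, which is
  \<open>(k + 1) u ^ k c\<close> times those forms. In characteristic zero \<open>k + 1\<close> is
  invertible.\<close>

lemma power_sums_prod_list:
  fixes u :: "'a::field_char_0 vec"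
  assumes "u \<in> carrier_vec n" and "set cs \<subseteq> carrier_vec n"
  shows "lin_form n u ^ k * prod_list (map (lin_form n) cs) \<in> power_sums n (k + length cs)"
  using assms
proof (induction cs arbitrary: u k)
  case Nil
  then show ?case by (simp add: power_sums_power)
next
  case (Cons c cs)
  interpret pc: comm_ring_hom "pconst :: 'a \<Rightarrow> 'a mpoly" by (rule comm_ring_hom_pconst)
  have c: "c \<in> carrier_vec n" using Cons by auto
  let ?W = "power_sums n (k + length (c # cs)) :: 'a mpoly set"
  let ?P = "prod_list (map (lin_form n) cs)"
  have lin: "lin_form n (u + t \<cdot>\<^sub>v c) = lin_form n u + pconst t * lin_form n c" for t
    using Cons.prems c
    by (simp add: lin_form_sum sum_distrib_left sum.distrib[symmetric] hom_distribs algebra_simps)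
  \<comment> \<open>The coefficient of \<open>t ^ i\<close> in the binomial expansion; only
    \<open>i = 1\<close> is needed.\<close>
  let ?f = "\<lambda>i. pconst (of_nat (Suc k choose i)) * lin_form n c ^ i * lin_form n u ^ (Suc k - i) * ?P"
  have "?f 1 \<in> ?W"
  proof (rule polynomial_values_imp_coeffs[where f = ?f and d = "Suc k"])
    fix t :: 'a
    have "lin_form n (u + t \<cdot>\<^sub>v c) ^ Suc k * ?P \<in> power_sums n (Suc k + length cs)"
      using Cons.prems by (intro Cons.IH) auto
    also have "lin_form n (u + t \<cdot>\<^sub>v c) ^ Suc k * ?P = (\<Sum>i\<le>Suc k. pconst (t ^ i) * ?f i)"
      unfolding lin add.commute[of "lin_form n u"] binomial_ring sum_distrib_right
      by (intro sum.cong refl) (simp add: pc.hom_power pc.hom_of_nat power_mult_distrib ac_simps)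
    finally show "(\<Sum>i\<le>Suc k. pconst (t ^ i) * ?f i) \<in> ?W" by simp
  qed (auto intro: power_sums_add power_sums_scale)
  then have "pconst (inverse (of_nat (Suc k))) * ?f 1 \<in> ?W"
    by (rule power_sums_scale)
  also have "pconst (inverse (of_nat (Suc k))) * ?f 1 =
      pconst (inverse (of_nat (Suc k)) * of_nat (Suc k)) * (lin_form n u ^ k * prod_list (map (lin_form n) (c # cs)))"
    unfolding pc.hom_mult by (simp add: ac_simps del: of_nat_Suc)
  also have "inverse (of_nat (Suc k)) * of_nat (Suc k) = (1 :: 'a)"
    by (simp del: of_nat_Suc)
  finally show ?case by simp
qed

lemma lin_form_unit_vec: "i < n \<Longrightarrow> lin_form n (unit_vec n i) = pvar i"
proof -
  assume i: "i < n"
  have "lin_form n (unit_vec n i) = (\<Sum>j<n. if j = i then pvar j else 0)"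
    unfolding lin_form_sum[OF unit_vec_carrier]
    using i by (intro sum.cong) (auto simp: unit_vec_def pconst_def)
  with i show ?thesis by simp
qed

text \<open>Variables are the linear forms of unit vectors, and they are split off one by one by
  induction on the degree.\<close>

lemma single_monomial_prod_list:
  assumes "Poly_Mapping.keys m \<subseteq> {..<n}"
  shows "\<exists>cs. set cs \<subseteq> carrier_vec n \<and> length cs = mon_degree m \<and>
    Poly_Mapping.single m 1 = prod_list (map (lin_form n) cs :: 'a::comm_ring_1 mpoly list)"
  using assms
proof (induction "mon_degree m" arbitrary: m)
  case 0
  then have "Poly_Mapping.lookup m i = 0" for i
    by (cases "i \<in> Poly_Mapping.keys m") (auto simp: mon_degree_def in_keys_iff)
  then have "m = 0" by (intro poly_mapping_eqI) simp
  then show ?case by (auto intro!: exI[of _ "[]"])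
next
  case (Suc k)
  then obtain i where i: "i \<in> Poly_Mapping.keys m" by (force simp: mon_degree_def)
  define m' where "m' = m - Poly_Mapping.single i 1"
  have m: "m = Poly_Mapping.single i 1 + m'"
    using i by (intro poly_mapping_eqI) (auto simp: m'_def lookup_add lookup_minus lookup_single when_def in_keys_iff)
  have "k = mon_degree m'" using Suc(2) unfolding m by (simp add: mon_degree_add)
  moreover have "Poly_Mapping.keys m' \<subseteq> {..<n}"
    using Suc.prems unfolding m'_def subset_iff in_keys_iff lookup_minus by auto
  ultimately obtain cs where cs: "set cs \<subseteq> carrier_vec n" "length cs = mon_degree m'"
    "Poly_Mapping.single m' 1 = prod_list (map (lin_form n) cs :: 'a mpoly list)"
    using Suc(1) by blast
  have "Poly_Mapping.single m 1 = pvar i * (Poly_Mapping.single m' 1 :: 'a mpoly)"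
    by (simp add: m pvar_def mult_single)
  moreover have "i < n" using i Suc.prems by auto
  ultimately show ?case
    using cs by (intro exI[of _ "unit_vec n i # cs"]) (auto simp: lin_form_unit_vec m mon_degree_add)
qed

lemma homogeneous_in_power_sums:
  fixes p :: "'a::field_char_0 mpoly"
  assumes "poly_in n p" and "homogeneous d p" and "n > 0"
  shows "p \<in> power_sums n d"
proof -
  have "p = (\<Sum>m\<in>Poly_Mapping.keys p. Poly_Mapping.single m (Poly_Mapping.lookup p m))"
    by (intro poly_mapping_eqI) (auto simp: lookup_sum lookup_single when_def in_keys_iff)
  also have "\<dots> \<in> power_sums n d"
  proof -
    have mono: "Poly_Mapping.single m a \<in> power_sums n d"
      if "m \<in> Poly_Mapping.keys p" for m and a :: 'a
    proof -
      have m: "Poly_Mapping.keys m \<subseteq> {..<n}" "mon_degree m = d"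
        using assms that by (auto simp: poly_in_def homogeneous_def)
      then obtain cs where cs: "set cs \<subseteq> carrier_vec n" "length cs = d"
        "Poly_Mapping.single m 1 = prod_list (map (lin_form n) cs :: 'a mpoly list)"
        using single_monomial_prod_list by blast
      \<comment> \<open>With exponent 0 the auxiliary form becomes 1, whatever vector it is built
        from; the zero vector serves.\<close>
      then show ?thesis
        using power_sums_scale[OF power_sums_prod_list[of "0\<^sub>v n" n cs 0], of a]
        by (simp add: single_eq_pconst_mult[of m a])
    qed
    have "(\<Sum>m\<in>A. Poly_Mapping.single m (Poly_Mapping.lookup p m)) \<in> power_sums n d"
      if "A \<subseteq> Poly_Mapping.keys p" for A
      using finite_subset[OF that finite_keys] that
      by (induction A rule: finite_induct) (auto intro: power_sums_0 power_sums_add mono)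
    then show ?thesis by blast
  qed
  finally show ?thesis .
qed

text \<open>Each component is a power sum with its own family of forms. The families are
  concatenated, and each form gets a coefficient vector supported on the component it came
  from.\<close>

lemma homogeneous_map_power_sum:
  fixes H :: "'a::field_char_0 mpoly vec"
  assumes H: "homogeneous_map n d H"
  obtains M and b c :: "nat \<Rightarrow> 'a vec" where "\<forall>i<M. b i \<in> carrier_vec n" "\<forall>i<M. c i \<in> carrier_vec n"
    "H = vec n (\<lambda>k. \<Sum>i<M::nat. lin_form n (c i) ^ d * pconst (b i $ k))"
proof -
  have "\<forall>k. \<exists>N a c. k < n \<longrightarrow> (\<forall>i<N. c i \<in> carrier_vec n) \<and>
     H $ k = (\<Sum>i<N::nat. lin_form n (c i) ^ d * pconst (a i))"
  proof
    fix k
    show "\<exists>N a c. k < n \<longrightarrow> (\<forall>i<N. c i \<in> carrier_vec n) \<and>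
       H $ k = (\<Sum>i<N::nat. lin_form n (c i) ^ d * pconst (a i))"
    proof (cases "k < n")
      case True
      then have "H $ k \<in> power_sums n d"
        using H homogeneous_in_power_sums[of n "H $ k" d] by (auto simp: homogeneous_map_iff)
      then show ?thesis unfolding power_sums_def by simp
    qed simp
  qed
  then have "\<exists>N a c. \<forall>k. k < n \<longrightarrow> (\<forall>i<N k. c k i \<in> carrier_vec n) \<and>
     H $ k = (\<Sum>i<N k::nat. lin_form n (c k i) ^ d * pconst (a k i))"
    unfolding choice_iff .
  then obtain N a c where Nac: "\<forall>k. k < n \<longrightarrow> (\<forall>i<N k. c k i \<in> carrier_vec n) \<and>
     H $ k = (\<Sum>i<N k::nat. lin_form n (c k i) ^ d * pconst (a k i))"
    by (elim exE)
  \<comment> \<open>The disjoint union of the index sets of all components; \<open>h\<close>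
    enumerates it.\<close>
  define I where "I = (SIGMA l:{..<n}. {..<N l})"
  have "finite I" by (simp add: I_def)
  from ex_bij_betw_nat_finite[OF this] obtain h where h: "bij_betw h {0..<card I} I" ..
  have hI: "fst (h i) < n" "snd (h i) < N (fst (h i))" if "i < card I" for i
  proof -
    have "(fst (h i), snd (h i)) \<in> I"
      using bij_betw_apply[OF h, of i] that by simp
    then show "fst (h i) < n" "snd (h i) < N (fst (h i))"
      unfolding I_def by (simp_all only: mem_Sigma_iff lessThan_iff)
  qed
  define b' where "b' = (\<lambda>i. vec n (\<lambda>k. if k = fst (h i) then a (fst (h i)) (snd (h i)) else 0))"
  define c' where "c' = (\<lambda>i. c (fst (h i)) (snd (h i)))"
  have "H $ k = (\<Sum>i<card I. lin_form n (c' i) ^ d * pconst (b' i $ k))" if k: "k < n" for k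
  proof -
    have "(\<Sum>i<card I. lin_form n (c' i) ^ d * pconst (b' i $ k)) =
        (\<Sum>i\<in>{0..<card I}. (\<lambda>(l, i). if l = k then lin_form n (c l i) ^ d * pconst (a l i) else 0) (h i))"
      using k by (intro sum.cong) (auto simp: c'_def b'_def case_prod_beta pconst_def)
    also have "\<dots> = (\<Sum>(l, i)\<in>I. if l = k then lin_form n (c l i) ^ d * pconst (a l i) else 0)"
      by (rule sum.reindex_bij_betw[OF h])
    also have "\<dots> = (\<Sum>l<n. \<Sum>i<N l. if l = k then lin_form n (c l i) ^ d * pconst (a l i) else 0)"
      unfolding I_def by (rule sum.Sigma[symmetric]) auto
    also have "\<dots> = (\<Sum>l<n. if l = k then \<Sum>i<N l. lin_form n (c l i) ^ d * pconst (a l i) else 0)"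
      by (intro sum.cong) auto
    also have "\<dots> = H $ k" using k Nac by simp
    finally show ?thesis by simp
  qed
  then have "H = vec n (\<lambda>k. \<Sum>i<card I. lin_form n (c' i) ^ d * pconst (b' i $ k))"
    using H by (auto simp: homogeneous_map_iff)
  moreover have "\<forall>i<card I. b' i \<in> carrier_vec n" "\<forall>i<card I. c' i \<in> carrier_vec n"
    using hI Nac by (auto simp: b'_def c'_def)
  ultimately show ?thesis by (intro that)
qed

subsection \<open>The star property\<close>

definition map_value :: "'a::comm_ring_1 mpoly vec \<Rightarrow> 'a vec \<Rightarrow> 'a vec" where
  "map_value H v = map_vec (psubst (\<lambda>x. x) v) H"

text \<open>An increment of \<open>H\<close> is a combination of the \<open>b i\<close> whose
  coefficient at \<open>i\<close> vanishes once \<open>c i\<close> annihilates the direction. By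
  triangular orthogonality, annihilation thus passes around the cycle \<open>u\<close>,
  \<open>w\<close> while moving up in the index, until all forms annihilate both directions and the
  increments are zero.\<close>

lemma star_property_no_cycle:
  fixes H :: "'a::comm_ring_1 mpoly vec"
  assumes star: "star_property n d H"
    and carrier: "x \<in> carrier_vec n" "y \<in> carrier_vec n" "u \<in> carrier_vec n" "w \<in> carrier_vec n"
    and xu: "map_value H (x + u) - map_value H x = w"
    and yw: "map_value H (y + w) - map_value H y = u"
  shows "w = 0\<^sub>v n"
proof -
  from star obtain N and b c :: "nat \<Rightarrow> 'a vec" and e where
    bc: "\<forall>i\<in>{1..N}. b i \<in> carrier_vec n \<and> c i \<in> carrier_vec n \<and> e i \<in> {1..d}" and
    orth: "\<forall>i j. 1 \<le> j \<and> j \<le> i \<and> i \<le> N \<longrightarrow> c j \<bullet> b i = 0" and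
    H: "H = vec n (\<lambda>k. \<Sum>i=1..N. lin_form n (c i) ^ e i * pconst (b i $ k))"
    unfolding star_property_def by (elim exE conjE) (rule that)
  interpret ev: comm_ring_hom "psubst (\<lambda>x. x) v" for v :: "'a vec"
    by (rule comm_ring_hom_psubst[OF comm_ring_hom_id])
  have ev_lin: "psubst (\<lambda>x. x) v (lin_form n (c i)) = c i \<bullet> v"
    if "i \<in> {1..N}" "v \<in> carrier_vec n" for i v
    using that bc by (simp add: psubst_lin_form[OF comm_ring_hom_id] scalar_prod_def atLeast0LessThan)
  have dim_value [simp]: "dim_vec (map_value H v) = n" for v
    by (simp add: map_value_def H)
  have dim_b [simp]: "dim_vec (b i) = n" if "i \<in> {1..N}" for i
    using that bc carrier_vecD by blast
  have val: "map_value H v $ k = (\<Sum>i=1..N. (c i \<bullet> v) ^ e i * b i $ k)"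
    if "v \<in> carrier_vec n" "k < n" for v k
    using that by (simp add: map_value_def H ev.hom_sum ev.hom_mult ev.hom_power ev_lin
        psubst_pconst[OF comm_ring_hom_id])
  have step: "(c j \<bullet> q) = 0"
    if diff: "map_value H (z + p) - map_value H z = q" and zp: "z \<in> carrier_vec n" "p \<in> carrier_vec n"
      and j: "j \<in> {1..N}" and below: "\<And>i. i \<in> {1..<j} \<Longrightarrow> c i \<bullet> p = 0" for z p q j
  proof -
    define a where "a i = (c i \<bullet> (z + p)) ^ e i - (c i \<bullet> z) ^ e i" for i
    have q: "q $ k = (\<Sum>i=1..N. a i * b i $ k)" if "k < n" for k
    proof -
      have "q $ k = map_value H (z + p) $ k - map_value H z $ k"
        using that unfolding diff[symmetric] by simp
      then show ?thesis
        using that zp by (simp add: val sum_subtractf[symmetric] a_def algebra_simps)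
    qed
    have a: "a i = 0" if "i \<in> {1..<j}" for i
      using below[OF that] bc zp that j by (simp add: a_def scalar_prod_add_distrib[of _ n])
    have dim: "dim_vec q = n" using diff by auto
    have "c j \<bullet> q = (\<Sum>k<n. \<Sum>i=1..N. c j $ k * (a i * b i $ k))"
      using dim by (simp add: scalar_prod_def atLeast0LessThan q sum_distrib_left)
    also have "\<dots> = (\<Sum>i=1..N. a i * (\<Sum>k<n. c j $ k * b i $ k))"
      by (subst sum.swap) (simp add: sum_distrib_left mult.left_commute)
    also have "\<dots> = (\<Sum>i=1..N. a i * (c j \<bullet> b i))"
      by (intro sum.cong refl) (simp add: scalar_prod_def atLeast0LessThan)
    \<comment> \<open>Below \<open>j\<close> the coefficient \<open>a i\<close> is zero; from
      \<open>j\<close> on \<open>c j\<close> is orthogonal to \<open>b i\<close>.\<close>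
    also have "\<dots> = 0"
    proof (rule sum.neutral, rule ballI)
      fix i assume "i \<in> {1..N}"
      then show "a i * (c j \<bullet> b i) = 0"
        using a[of i] orth j by (cases "i < j") auto
    qed
    finally show ?thesis .
  qed
  \<comment> \<open>Both claims go through one strong induction, as each at \<open>j\<close> uses
    the other below \<open>j\<close>. For \<open>j = 1\<close> the condition on smaller indices is
    empty.\<close>
  have uw: "c j \<bullet> u = 0 \<and> c j \<bullet> w = 0" if "j \<in> {1..N}" for j
    using that
  proof (induction j rule: less_induct)
    case (less j)
    then have "\<And>i. i \<in> {1..<j} \<Longrightarrow> c i \<bullet> u = 0" "\<And>i. i \<in> {1..<j} \<Longrightarrow> c i \<bullet> w = 0" by auto
    then show ?case
      using step[OF xu carrier(1,3) less.prems] step[OF yw carrier(2,4) less.prems] by blast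
  qed
  have "map_value H (x + u) = map_value H x"
  proof (rule eq_vecI)
    fix k assume "k < dim_vec (map_value H x)"
    then have k: "k < n" by simp
    have "c i \<bullet> (x + u) = c i \<bullet> x" if "i \<in> {1..N}" for i
      using uw[OF that] bc that carrier by (simp add: scalar_prod_add_distrib[of _ n])
    then show "map_value H (x + u) $ k = map_value H x $ k"
      using k carrier by (simp add: val)
  qed simp
  then show ?thesis
    using xu by (auto simp: vec_eq_iff)
qed

subsection \<open>Pairing with a power linear map\<close>

text \<open>Associativity of substitution. The bound on the variables of \<open>p\<close> ensures
  that every entry of \<open>u\<close> that is looked up exists.\<close>

lemma psubst_psubst_pconst:
  fixes u :: "'a::comm_ring_1 mpoly vec"
  assumes h: "comm_ring_hom h" and p: "poly_in (dim_vec u) p"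
  shows "psubst h v (psubst pconst u p) = psubst h (map_vec (psubst h v) u) p"
proof -
  interpret ev: comm_ring_hom "psubst h v" by (rule comm_ring_hom_psubst[OF h])
  have "psubst h v (u $ i) = map_vec (psubst h v) u $ i"
    if "m \<in> Poly_Mapping.keys p" "i \<in> Poly_Mapping.keys m" for m i
    using p that by (subst index_map_vec) (auto simp: poly_in_def)
  then show ?thesis
    unfolding psubst_def[of pconst] psubst_def[of h "map_vec (psubst h v) u"]
    by (simp add: ev.hom_sum ev.hom_mult ev.hom_prod ev.hom_power psubst_pconst[OF h])
qed

lemma psubst_id_map_lin_form:
  assumes "c \<in> carrier_vec n"
  shows "psubst pconst (id_map n) (lin_form n c) = lin_form n c"
  by (subst psubst_lin_form[OF comm_ring_hom_pconst assms]) (simp add: lin_form_sum[OF assms] id_map_def)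

lemma dir_deriv_scale: "dir_deriv n h v (r \<cdot>\<^sub>v w) p = r * dir_deriv n h v w p"
  if "w \<in> carrier_vec n"
  using that by (simp add: dir_deriv_def sum_distrib_left mult.left_commute)

text \<open>
  Here \<open>b i\<close> are the columns of \<open>B\<close> and \<open>c i\<close> the rows of \<open>C\<close>. The columns \<open>s k\<close> of \<open>B\<close> form
  an identity matrix, which makes \<open>lift\<close> a right inverse of \<open>proj h\<close>, the map \<open>X \<mapsto> B X\<close>.
\<close>
locale power_sum_map =
  fixes n N d :: nat and b c :: "nat \<Rightarrow> 'a::field_char_0 vec" and s :: "nat \<Rightarrow> nat"
    and H :: "'a mpoly vec"
  assumes b: "i < N \<Longrightarrow> b i \<in> carrier_vec n"
    and c: "i < N \<Longrightarrow> c i \<in> carrier_vec n"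
    and H_def: "H = vec n (\<lambda>k. \<Sum>i<N. lin_form n (c i) ^ d * pconst (b i $ k))"
    and s: "k < n \<Longrightarrow> s k < N" and bs: "k < n \<Longrightarrow> b (s k) = unit_vec n k"
begin

text \<open>With \<open>q\<close> as the map \<open>x \<mapsto> (C x) ^ d\<close>, the given map
  \<open>H\<close> is \<open>B q\<close>. Next, \<open>A i\<close> is row \<open>i\<close> of
  \<open>C B\<close>, so \<open>P\<close> is \<open>X \<mapsto> (C B X) ^ d\<close>, that is,
  \<open>q\<close> after \<open>B\<close>.\<close>

definition q :: "nat \<Rightarrow> 'a mpoly" where "q i = lin_form n (c i) ^ d"

definition A :: "nat \<Rightarrow> 'a vec" where "A i = vec N (\<lambda>j. c i \<bullet> b j)"

definition P :: "'a mpoly vec" where "P = vec N (\<lambda>i. lin_form N (A i) ^ d)"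

definition proj :: "('a \<Rightarrow> 'b::comm_ring_1) \<Rightarrow> 'b vec \<Rightarrow> 'b vec" where
  "proj h Z = vec n (\<lambda>k. \<Sum>i<N. h (b i $ k) * Z $ i)"

text \<open>Puts \<open>v $ k\<close> at coordinate \<open>s k\<close>. Writing this as a sum avoids
  an inverse of \<open>s\<close>.\<close>

definition lift :: "'b::comm_ring_1 vec \<Rightarrow> 'b vec" where
  "lift v = vec N (\<lambda>i. \<Sum>k<n. if i = s k then v $ k else 0)"

lemma A_carrier [simp]: "A i \<in> carrier_vec N" by (simp add: A_def)

lemma H_carrier [simp]: "H \<in> carrier_vec n" by (simp add: H_def)

lemma P_carrier [simp]: "P \<in> carrier_vec N" by (simp add: P_def)

lemma dims [simp]: "dim_vec H = n" "dim_vec P = N"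
  by (simp_all add: H_def P_def)

lemma proj_carrier [simp]: "proj h Z \<in> carrier_vec n" by (simp add: proj_def)

lemma lift_carrier [simp]: "lift v \<in> carrier_vec N" by (simp add: lift_def)

lemma H_nth: "k < n \<Longrightarrow> H $ k = (\<Sum>i<N. q i * pconst (b i $ k))"
  by (simp add: H_def q_def)

lemma power_linear_P: "power_linear N d P"
  unfolding power_linear_def P_def by (intro exI[of _ A]) simp

lemma homogeneous_map_P: "homogeneous_map N d P"
  using homogeneous_power[OF homogeneous_lin_form, of "A i" N d for i]
  by (auto simp: homogeneous_map_iff P_def intro!: poly_in_power poly_in_lin_form)

section \<open>Values and derivatives of the power linear map through the projection\<close>

context
  fixes h :: "'a \<Rightarrow> 'b::comm_ring_1"
  assumes h: "comm_ring_hom h"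
begin

interpretation comm_ring_hom h by (rule h)
interpretation ev: comm_ring_hom "psubst h v" for v by (rule comm_ring_hom_psubst[OF h])

text \<open>After exchanging the sums only \<open>i = s k\<close> survives, and that column is the
  unit vector \<open>k\<close>.\<close>

lemma proj_lift:
  assumes v: "v \<in> carrier_vec n"
  shows "proj h (lift v) = v"
proof (rule eq_vecI)
  fix l assume "l < dim_vec v"
  then have l: "l < n" using v by simp
  have "proj h (lift v) $ l = (\<Sum>i<N. \<Sum>k<n. if i = s k then h (b i $ l) * v $ k else 0)"
    using l by (simp add: proj_def lift_def sum_distrib_left if_distrib cong: if_cong)
  also have "\<dots> = (\<Sum>k<n. \<Sum>i<N. if i = s k then h (b i $ l) * v $ k else 0)"
    by (rule sum.swap)
  also have "\<dots> = (\<Sum>k<n. if k = l then v $ k else 0)"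
    using s bs l by (intro sum.cong refl) (auto simp: unit_vec_def)
  also have "\<dots> = v $ l" using l by simp
  finally show "proj h (lift v) $ l = v $ l" .
qed (use v in \<open>simp add: proj_def\<close>)

text \<open>This is \<open>(C B) Z = C (B Z)\<close>. It makes \<open>P\<close> depend on its
  argument, and its derivative on point and direction, only through \<open>proj h\<close>.\<close>

lemma A_scalar:
  assumes i: "i < N"
  shows "(\<Sum>j<N. h (A i $ j) * Z $ j) = (\<Sum>k<n. h (c i $ k) * proj h Z $ k)"
proof -
  have "(\<Sum>j<N. h (A i $ j) * Z $ j) = (\<Sum>j<N. \<Sum>k<n. h (c i $ k) * h (b j $ k) * Z $ j)"
    by (intro sum.cong refl)
      (simp add: carrier_vecD[OF b] A_def scalar_prod_def atLeast0LessThan hom_sum hom_mult sum_distrib_right)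
  also have "\<dots> = (\<Sum>k<n. \<Sum>j<N. h (c i $ k) * h (b j $ k) * Z $ j)"
    by (rule sum.swap)
  also have "\<dots> = (\<Sum>k<n. h (c i $ k) * proj h Z $ k)"
    by (simp add: proj_def sum_distrib_left mult.assoc)
  finally show ?thesis .
qed

lemma psubst_lin_form_A:
  "i < N \<Longrightarrow> psubst h Z (lin_form N (A i)) = psubst h (proj h Z) (lin_form n (c i))"
  by (simp add: psubst_lin_form[OF h] c A_scalar)

lemma psubst_P: "i < N \<Longrightarrow> psubst h Z (P $ i) = psubst h (proj h Z) (q i)"
  by (simp add: P_def q_def ev.hom_power psubst_lin_form_A)

lemma dir_deriv_P: "i < N \<Longrightarrow> dir_deriv N h Z W (P $ i) = dir_deriv n h (proj h Z) (proj h W) (q i)"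
  by (simp add: P_def q_def dir_deriv_power[OF h] psubst_lin_form_A dir_deriv_lin_form[OF h] c A_scalar)

lemma psubst_H: "k < n \<Longrightarrow> psubst h v (H $ k) = (\<Sum>i<N. h (b i $ k) * psubst h v (q i))"
  by (simp add: H_nth ev.hom_sum ev.hom_mult psubst_pconst[OF h] mult.commute)

lemma dir_deriv_H:
  "k < n \<Longrightarrow> dir_deriv n h v w (H $ k) = (\<Sum>i<N. h (b i $ k) * dir_deriv n h v w (q i))"
  by (simp add: H_nth dir_deriv_sum[OF h] dir_deriv_mult[OF h] dir_deriv_pconst[OF h]
      psubst_pconst[OF h] mult.commute)

end

text \<open>A kernel vector \<open>W\<close> for \<open>P\<close> projects to a kernel vector for
  \<open>H\<close> at the projected points, so \<open>B W = 0\<close>. The derivatives of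
  \<open>P\<close> along \<open>W\<close> see only \<open>B W\<close>, which leaves
  \<open>r W = 0\<close>.\<close>

lemma jacobian_sums_nonsingular_P:
  assumes ns: "jacobian_sums_nonsingular r n (id_map n + H)" and r: "r > 0"
  shows "jacobian_sums_nonsingular r N (id_map N + P)"
  unfolding jacobian_sums_nonsingular_iff_kernel[OF P_carrier]
proof (intro allI impI ballI)
  fix Z :: "nat \<Rightarrow> 'a alg_closure vec" and W :: "'a alg_closure vec"
  assume W: "W \<in> carrier_vec N"
    and ker: "\<forall>i<N. of_nat r * W $ i + (\<Sum>k = 1..r. dir_deriv N to_ac (Z k) W (P $ i)) = 0"
  let ?v = "\<lambda>k. proj to_ac (Z k)" and ?w = "proj to_ac W"
  have ker': "of_nat r * W $ i + (\<Sum>k = 1..r. dir_deriv n to_ac (?v k) ?w (q i)) = 0" if "i < N" for i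
    using ker that by (simp add: dir_deriv_P[OF comm_ring_hom_to_ac])
  have "of_nat r * ?w $ l + (\<Sum>k = 1..r. dir_deriv n to_ac (?v k) ?w (H $ l)) = 0" if l: "l < n" for l
  proof -
    have "(\<Sum>k = 1..r. dir_deriv n to_ac (?v k) ?w (H $ l)) =
        (\<Sum>i<N. \<Sum>k = 1..r. to_ac (b i $ l) * dir_deriv n to_ac (?v k) ?w (q i))"
      unfolding dir_deriv_H[OF comm_ring_hom_to_ac l] by (rule sum.swap)
    then have "of_nat r * ?w $ l + (\<Sum>k = 1..r. dir_deriv n to_ac (?v k) ?w (H $ l)) =
        (\<Sum>i<N. to_ac (b i $ l) * (of_nat r * W $ i + (\<Sum>k = 1..r. dir_deriv n to_ac (?v k) ?w (q i))))"
      using l by (simp add: proj_def sum_distrib_left distrib_left sum.distrib mult.left_commute)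
    also have "\<dots> = 0" using ker' by simp
    finally show ?thesis .
  qed
  then have w0: "?w = 0\<^sub>v n"
    using ns unfolding jacobian_sums_nonsingular_iff_kernel[OF H_carrier] by (meson proj_carrier)
  have "dir_deriv n to_ac v ?w p = 0" for v p
    unfolding w0 dir_deriv_def by simp
  then have "W $ i = 0" if "i < N" for i
    using ker'[OF that] r by simp
  then show "W = 0\<^sub>v N" using W by auto
qed

text \<open>Conversely, a kernel vector for \<open>H\<close> is lifted, with the points lifted by
  the right inverse of the projection.\<close>

lemma jacobian_sums_singular_P:
  assumes sing: "\<not> jacobian_sums_nonsingular r n (id_map n + H)" and r: "r > 0"
  shows "\<not> jacobian_sums_nonsingular r N (id_map N + P)"
proof
  assume ns: "jacobian_sums_nonsingular r N (id_map N + P)"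
  from sing obtain v w where v: "\<forall>k\<in>{1..r}. v k \<in> carrier_vec n" and w: "w \<in> carrier_vec n"
    and ker: "\<forall>i<n. of_nat r * w $ i + (\<Sum>k = 1..r. dir_deriv n to_ac (v k) w (H $ i)) = 0"
    and w0: "w \<noteq> 0\<^sub>v n"
    unfolding jacobian_sums_nonsingular_iff_kernel[OF H_carrier] by blast
  \<comment> \<open>The kernel equation for \<open>P\<close> reads
    \<open>r W = - (sum of the derivatives of q along B W)\<close>. This choice solves it, because
    the kernel equation for \<open>H\<close> gives \<open>B W = - r w\<close>.\<close>
  define W where "W = vec N (\<lambda>i. \<Sum>k = 1..r. dir_deriv n to_ac (v k) w (q i))"
  have W: "W \<in> carrier_vec N" by (simp add: W_def)
  have projW: "proj to_ac W = (- of_nat r) \<cdot>\<^sub>v w"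
  proof (rule eq_vecI)
    fix l assume "l < dim_vec ((- of_nat r) \<cdot>\<^sub>v w)"
    then have l: "l < n" using w by simp
    have "proj to_ac W $ l = (\<Sum>i<N. \<Sum>k = 1..r. to_ac (b i $ l) * dir_deriv n to_ac (v k) w (q i))"
      using l by (simp add: proj_def W_def sum_distrib_left)
    also have "\<dots> = (\<Sum>k = 1..r. dir_deriv n to_ac (v k) w (H $ l))"
      unfolding dir_deriv_H[OF comm_ring_hom_to_ac l] by (rule sum.swap)
    also have "\<dots> = - of_nat r * w $ l"
      using ker l by (simp add: eq_neg_iff_add_eq_0 add.commute)
    finally show "proj to_ac W $ l = ((- of_nat r) \<cdot>\<^sub>v w) $ l"
      using l w by simp
  qed (use w in \<open>simp add: proj_def\<close>)
  have "of_nat r * W $ i + (\<Sum>k = 1..r. dir_deriv N to_ac (lift (v k)) W (P $ i)) = 0" if i: "i < N" for i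
  proof -
    have "(\<Sum>k = 1..r. dir_deriv N to_ac (lift (v k)) W (P $ i)) =
        (\<Sum>k = 1..r. - of_nat r * dir_deriv n to_ac (v k) w (q i))"
      using v w i by (intro sum.cong refl)
        (simp add: dir_deriv_P[OF comm_ring_hom_to_ac] proj_lift[OF comm_ring_hom_to_ac] projW dir_deriv_scale)
    then show ?thesis
      using i by (simp add: W_def sum_distrib_left sum_negf)
  qed
  moreover have "\<forall>w\<in>carrier_vec N.
      (\<forall>i<N. of_nat r * w $ i + (\<Sum>k = 1..r. dir_deriv N to_ac (lift (v k)) w (P $ i)) = 0) \<longrightarrow> w = 0\<^sub>v N"
    using ns[unfolded jacobian_sums_nonsingular_iff_kernel[OF P_carrier], THEN spec[of _ "\<lambda>k. lift (v k)"]] by simp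
  ultimately have "W = 0\<^sub>v N" using W by simp
  then have "(- of_nat r) \<cdot>\<^sub>v w = 0\<^sub>v n"
    unfolding projW[symmetric] by (simp add: proj_def zero_vec_def)
  then have "w $ i = 0" if "i < n" for i
    using that w r by (auto simp: vec_eq_iff)
  then show False using w w0 by auto
qed

text \<open>A cycle of increments of \<open>H\<close> lifts to one of \<open>P\<close>: the base
  points are lifted, and the directions become the corresponding increments of \<open>q\<close>,
  which \<open>B\<close> maps back to \<open>w\<close> and \<open>u\<close>.\<close>

lemma not_star_property_P:
  assumes carrier: "x \<in> carrier_vec n" "y \<in> carrier_vec n" "u \<in> carrier_vec n" "w \<in> carrier_vec n"
    and xu: "map_value H (x + u) - map_value H x = w"
    and yw: "map_value H (y + w) - map_value H y = u"
    and w: "w \<noteq> 0\<^sub>v n"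
  shows "\<not> star_property N d P"
proof
  assume star: "star_property N d P"
  let ?q = "\<lambda>v. vec N (\<lambda>i. psubst (\<lambda>x. x) v (q i))"
  have proj_add: "proj (\<lambda>x. x) (Z + Y) = proj (\<lambda>x. x) Z + proj (\<lambda>x. x) Y"
    if "Z \<in> carrier_vec N" "Y \<in> carrier_vec N" for Z Y
    using that by (auto simp: proj_def algebra_simps sum.distrib)
  have proj_q: "proj (\<lambda>x. x) (?q v - ?q v') = map_value H v - map_value H v'" for v v'
    by (rule eq_vecI) (auto simp: proj_def map_value_def psubst_H[OF comm_ring_hom_id]
        algebra_simps sum_subtractf)
  \<comment> \<open>The direction projects to \<open>t\<close> and \<open>lift z\<close> projects to
    \<open>z\<close>, so the left side is the increment of \<open>q\<close> from \<open>z\<close> to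
    \<open>z + t\<close>.\<close>
  have P_value: "map_value P (lift z + (?q v - ?q v')) - map_value P (lift z) = ?q (z + t) - ?q z"
    if "map_value H v - map_value H v' = t" "z \<in> carrier_vec n" for z v v' t
  proof (rule eq_vecI)
    fix i assume "i < dim_vec (?q (z + t) - ?q z)"
    then have "i < N" by simp
    then show "(map_value P (lift z + (?q v - ?q v')) - map_value P (lift z)) $ i = (?q (z + t) - ?q z) $ i"
      using that by (simp add: map_value_def[of P] psubst_P[OF comm_ring_hom_id] proj_add
          proj_lift[OF comm_ring_hom_id] proj_q)
  qed (simp add: map_value_def P_def)
  have "?q (x + u) - ?q x = 0\<^sub>v N"
    by (rule star_property_no_cycle[OF star, of "lift x" "lift y" "?q (y + w) - ?q y"])
      (use P_value[OF yw carrier(1)] P_value[OF xu carrier(2)] in auto)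
  then have "proj (\<lambda>x. x) (?q (x + u) - ?q x) = 0\<^sub>v n"
    by (simp add: proj_def zero_vec_def)
  then show False using w xu unfolding proj_q by simp
qed

text \<open>If \<open>P\<close> were zero, evaluating it at \<open>lift v\<close> would make every
  \<open>q i\<close> vanish at \<open>v\<close>, and with them \<open>H\<close>.\<close>

lemma map_degree_P:
  assumes d: "d \<ge> 2" and v: "v \<in> carrier_vec n" and H0: "map_value H v \<noteq> 0\<^sub>v n"
  shows "map_degree (id_map N + P) = d"
proof -
  have "\<exists>i<N. P $ i \<noteq> 0"
  proof (rule ccontr)
    assume "\<not> (\<exists>i<N. P $ i \<noteq> 0)"
    then have "psubst (\<lambda>x. x) v (q i) = 0" if "i < N" for i
      using that psubst_P[OF comm_ring_hom_id, of i "lift v"] v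
      by (simp add: proj_lift[OF comm_ring_hom_id] psubst_def)
    then have "map_value H v = 0\<^sub>v n"
      by (intro eq_vecI) (auto simp: map_value_def psubst_H[OF comm_ring_hom_id] carrier_vecD[OF H_carrier])
    with H0 show False ..
  qed
  then show ?thesis
    using map_degree_id_plus_homogeneous[OF homogeneous_map_P d] by blast
qed

text \<open>Let \<open>g\<close> invert \<open>f = x + H\<close>. The inverse of
  \<open>F = X + P\<close> is \<open>G = X - q (g (B X))\<close>, since \<open>B G = g B\<close>
  gives \<open>P G = q g B\<close>, while \<open>B F = f B\<close> gives
  \<open>q g B F = q B = P\<close>.\<close>

lemma JC_minus_P:
  assumes "JC_minus n (id_map n + H)"
  shows "JC_minus N (id_map N + P)"
proof -
  let ?f = "id_map n + H" and ?F = "id_map N + P"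
  note pc = comm_ring_hom_pconst[where 'a = 'a]
  interpret pc: comm_ring_hom "pconst :: 'a \<Rightarrow> 'a mpoly" by (rule pc)
  interpret ev: comm_ring_hom "psubst pconst v" for v :: "'a mpoly vec" by (rule comm_ring_hom_psubst[OF pc])
  from assms obtain g :: "'a mpoly vec" where gm: "g \<in> poly_maps n"
    and fg: "compose_map ?f g = id_map n" and gf: "compose_map g ?f = id_map n"
    unfolding JC_minus_def by blast
  have g: "g \<in> carrier_vec n" "\<And>k. k < n \<Longrightarrow> poly_in n (g $ k)"
    using gm by (auto simp: poly_maps_iff)
  define B where "B = proj pconst (id_map N)"
  define G where "G = vec N (\<lambda>i. pvar i - psubst pconst B (psubst pconst g (q i)))"
  have dims [simp]: "dim_vec g = n" "dim_vec B = n" "dim_vec G = N" "dim_vec H = n" "dim_vec P = N"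
    "dim_vec (id_map m) = m" for m
    using g by (auto simp: B_def G_def proj_def H_def P_def id_map_def)
  have q_in: "i < N \<Longrightarrow> poly_in n (q i)" for i
    using c by (auto simp: q_def intro!: poly_in_power poly_in_lin_form)
  \<comment> \<open>The equation \<open>f g = x\<close>, solved for the linear part.\<close>
  have g_eq: "g $ k = pvar k - psubst pconst g (H $ k)" if "k < n" for k
    using arg_cong[OF fg, of "\<lambda>F :: 'a mpoly vec. F $ k"] that
    by (simp add: compose_map_def ev.hom_add id_map_def psubst_pvar[OF pc] eq_diff_eq)
  have B_q: "psubst pconst B (q i) = P $ i" if "i < N" for i
    using psubst_P[OF pc that, of "id_map N"] that
    by (simp add: B_def P_def ev.hom_power psubst_id_map_lin_form)
  have projG: "proj pconst G = map_vec (psubst pconst B) g"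
  proof (rule eq_vecI)
    fix k assume "k < dim_vec (map_vec (psubst pconst B) g)"
    then have k: "k < n" by simp
    have "proj pconst G $ k = B $ k - (\<Sum>i<N. pconst (b i $ k) * psubst pconst B (psubst pconst g (q i)))"
      using k by (simp add: proj_def G_def B_def id_map_def algebra_simps sum_subtractf)
    also have "\<dots> = psubst pconst B (g $ k)"
      using k by (simp add: g_eq[of k] ev.hom_minus psubst_pvar[OF pc] psubst_H[OF pc]
          ev.hom_sum ev.hom_mult psubst_pconst[OF pc])
    finally show "proj pconst G $ k = map_vec (psubst pconst B) g $ k" using k by simp
  qed (simp add: proj_def)
  have projF: "map_vec (psubst pconst ?F) B = map_vec (psubst pconst B) ?f"
  proof (rule eq_vecI)
    fix k assume "k < dim_vec (map_vec (psubst pconst B) ?f)"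
    then have k: "k < n" by simp
    have "map_vec (psubst pconst ?F) B $ k = (\<Sum>i<N. pconst (b i $ k) * (pvar i + P $ i))"
      using k by (simp add: B_def proj_def id_map_def ev.hom_sum ev.hom_mult psubst_pconst[OF pc] psubst_pvar[OF pc])
    also have "\<dots> = B $ k + (\<Sum>i<N. pconst (b i $ k) * P $ i)"
      using k by (simp add: B_def proj_def id_map_def distrib_left sum.distrib)
    also have "\<dots> = psubst pconst B (?f $ k)"
      using k by (simp add: id_map_def ev.hom_add psubst_pvar[OF pc] psubst_H[OF pc] B_q)
    finally show "map_vec (psubst pconst ?F) B $ k = map_vec (psubst pconst B) ?f $ k" using k by simp
  qed simp
  have "compose_map ?F G = id_map N"
  proof (rule eq_vecI)
    fix i assume "i < dim_vec (id_map N :: 'a mpoly vec)"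
    then have i: "i < N" by simp
    have "psubst pconst G (P $ i) = psubst pconst B (psubst pconst g (q i))"
      using i by (simp add: psubst_P[OF pc] projG psubst_psubst_pconst[OF pc] q_in)
    then show "compose_map ?F G $ i = id_map N $ i"
      using i by (simp add: compose_map_def id_map_def ev.hom_add psubst_pvar[OF pc] G_def)
  qed (simp add: compose_map_def)
  moreover have "compose_map G ?F = id_map N"
  proof (rule eq_vecI)
    fix i assume "i < dim_vec (id_map N :: 'a mpoly vec)"
    then have i: "i < N" by simp
    have gq_in: "poly_in n (psubst pconst g (q i))"
      using g i q_in by (intro poly_in_psubst) auto
    have "psubst pconst ?F (psubst pconst B (psubst pconst g (q i))) =
        psubst pconst (map_vec (psubst pconst B) ?f) (psubst pconst g (q i))"
      using gq_in by (simp add: psubst_psubst_pconst[OF pc] projF)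
    also have "\<dots> = psubst pconst B (psubst pconst ?f (psubst pconst g (q i)))"
      using gq_in by (simp add: psubst_psubst_pconst[OF pc])
    also have "psubst pconst ?f (psubst pconst g (q i)) = psubst pconst (compose_map g ?f) (q i)"
      using i q_in by (simp add: psubst_psubst_pconst[OF pc] compose_map_def)
    also have "\<dots> = q i"
      using i c by (simp add: gf q_def ev.hom_power psubst_id_map_lin_form)
    also have "psubst pconst B (q i) = P $ i" using i by (rule B_q)
    finally show "compose_map G ?F $ i = id_map N $ i"
      using i by (simp add: compose_map_def G_def ev.hom_minus psubst_pvar[OF pc] id_map_def)
  qed (simp add: compose_map_def)
  moreover have "G \<in> poly_maps N"
    unfolding poly_maps_iff
  proof (intro conjI allI impI)
    fix i assume i: "i < N"
    have "poly_in N (B $ k)" if "k < n" for k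
      using that by (auto simp: B_def proj_def id_map_def intro!: poly_in_sum poly_in_mult)
    then have "poly_in N (psubst pconst B (psubst pconst g (q i)))"
      using g i q_in by (intro poly_in_psubst[of n]) (auto intro: poly_in_psubst)
    then show "poly_in N (G $ i)"
      using i by (auto simp: G_def)
  qed (simp add: G_def)
  ultimately show ?thesis unfolding JC_minus_def by blast
qed

end

lemma map_degree_id_plus_map_value:
  assumes H: "homogeneous_map n d H" and d: "d \<ge> 2" and v: "map_value H v \<noteq> 0\<^sub>v n"
  shows "map_degree (id_map n + H) = d"
proof -
  have "\<exists>j<n. H $ j \<noteq> 0"
  proof (rule ccontr)
    assume "\<not> (\<exists>j<n. H $ j \<noteq> 0)"
    then have "map_value H v = 0\<^sub>v n"
      using H by (intro eq_vecI) (auto simp: map_value_def psubst_def homogeneous_map_iff)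
    with v show False ..
  qed
  then show ?thesis using map_degree_id_plus_homogeneous[OF H d] by blast
qed

text \<open>The forms are padded by \<open>n\<close> zero forms, whose powers vanish because
  \<open>d > 0\<close>. Their coefficient vectors are therefore free and are taken to be the unit
  vectors, which makes \<open>B\<close> surjective.\<close>

lemma homogeneous_map_pairing:
  fixes H :: "'a::field_char_0 mpoly vec"
  assumes H: "homogeneous_map n d H" and d: "d > 0"
  obtains N and b c :: "nat \<Rightarrow> 'a vec" and s where "power_sum_map n N d b c s H"
proof -
  obtain M and b c :: "nat \<Rightarrow> 'a vec" where b: "\<forall>i<M. b i \<in> carrier_vec n" and c: "\<forall>i<M. c i \<in> carrier_vec n"
    and H_eq: "H = vec n (\<lambda>k. \<Sum>i<M::nat. lin_form n (c i) ^ d * pconst (b i $ k))"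
    by (rule homogeneous_map_power_sum[OF H])
  let ?b = "\<lambda>i. if i < M then b i else unit_vec n (i - M)"
  let ?c = "\<lambda>i. if i < M then c i else 0\<^sub>v n"
  have lin0: "lin_form n (0\<^sub>v n) = (0 :: 'a mpoly)"
    by (simp add: lin_form_sum pconst_def)
  have "(\<Sum>i<M + n. lin_form n (?c i) ^ d * pconst (?b i $ k)) =
      (\<Sum>i<M. lin_form n (c i) ^ d * pconst (b i $ k))" for k
  proof -
    have "(\<Sum>i<M + n. lin_form n (?c i) ^ d * pconst (?b i $ k)) =
        (\<Sum>i<M + n. if i < M then lin_form n (c i) ^ d * pconst (b i $ k) else 0)"
      using d by (intro sum.cong refl) (simp add: lin0)
    then show ?thesis
      using sum_lessThan_append[of M "\<lambda>i. lin_form n (c i) ^ d * pconst (b i $ k)" "\<lambda>_. 0" n] by simp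
  qed
  then have "power_sum_map n (M + n) d ?b ?c (\<lambda>k. M + k) H"
    using b c by unfold_locales (auto simp: H_eq)
  then show ?thesis by (rule that)
qed

subsection \<open>The two homogeneous maps\<close>

definition map_a :: "nat \<Rightarrow> 'a::comm_ring_1 mpoly vec" where
  "map_a d = pvar 0 ^ (d - 3) \<cdot>\<^sub>v vec_of_list
    [0, 0, pvar 1 * (pvar 0 * pvar 2 - pvar 1 * pvar 3), pvar 0 * (pvar 0 * pvar 2 - pvar 1 * pvar 3)]"

definition map_b :: "nat \<Rightarrow> 'a::comm_ring_1 mpoly vec" where
  "map_b d = vec_of_list [0, 0, pvar 1 ^ (d - 1) * pvar 3,
    pvar 0 ^ (d - 1) * pvar 2 - pvar 1 ^ (d - 1) * pvar 4, pvar 0 ^ (d - 1) * pvar 3]"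

lemma map_a_nth:
  "dim_vec (map_a d) = 4"
  "map_a d $ 0 = 0"
  "map_a d $ Suc 0 = 0"
  "map_a d $ 2 = pvar 0 ^ (d - 3) * (pvar 1 * (pvar 0 * pvar 2 - pvar 1 * pvar 3))"
  "map_a d $ 3 = pvar 0 ^ (d - 3) * (pvar 0 * (pvar 0 * pvar 2 - pvar 1 * pvar 3))"
  by (simp_all add: map_a_def vec_of_list_index del: vec_of_list_Cons vec_of_list_Nil)

lemma map_b_nth:
  "dim_vec (map_b d) = 5"
  "map_b d $ 0 = 0"
  "map_b d $ Suc 0 = 0"
  "map_b d $ 2 = pvar 1 ^ (d - 1) * pvar 3"
  "map_b d $ 3 = pvar 0 ^ (d - 1) * pvar 2 - pvar 1 ^ (d - 1) * pvar 4"
  "map_b d $ 4 = pvar 0 ^ (d - 1) * pvar 3"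
  by (simp_all add: map_b_def vec_of_list_index del: vec_of_list_Cons vec_of_list_Nil)

lemma all_less_4: "(\<forall>i<4. R i) \<longleftrightarrow> R 0 \<and> R (Suc 0) \<and> R 2 \<and> R (3::nat)"
  by (simp add: numeral_eq_Suc All_less_Suc conj_ac)

lemma all_less_5: "(\<forall>i<5. R i) \<longleftrightarrow> R 0 \<and> R (Suc 0) \<and> R 2 \<and> R 3 \<and> R (4::nat)"
  by (simp add: numeral_eq_Suc All_less_Suc conj_ac)

lemma map_a_carrier: "map_a d \<in> carrier_vec 4"
  by (rule carrier_vecI) (rule map_a_nth)

lemma map_b_carrier: "map_b d \<in> carrier_vec 5"
  by (rule carrier_vecI) (rule map_b_nth)

lemma homogeneous_map_a:
  assumes "d \<ge> 3"
  shows "homogeneous_map 4 d (map_a d :: 'a::comm_ring_1 mpoly vec)"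
proof -
  have hom: "homogeneous d (pvar 0 ^ (d - 3) * (pvar i * (pvar 0 * pvar 2 - pvar 1 * pvar 3)) :: 'a mpoly)" for i
  proof -
    have "homogeneous ((d - 3) * Suc 0 + (Suc 0 + (Suc 0 + Suc 0)))
      (pvar 0 ^ (d - 3) * (pvar i * (pvar 0 * pvar 2 - pvar 1 * pvar 3)) :: 'a mpoly)"
      by (intro homogeneous_mult homogeneous_power homogeneous_pvar homogeneous_diff)
    moreover have "(d - 3) * Suc 0 + (Suc 0 + (Suc 0 + Suc 0)) = d" using assms by simp
    ultimately show ?thesis by (simp only:)
  qed
  have "poly_in 4 (pvar 0 ^ (d - 3) * (pvar i * (pvar 0 * pvar 2 - pvar 1 * pvar 3)) :: 'a mpoly)" if "i < 4" for i
    using that by (intro poly_in_mult poly_in_power poly_in_diff poly_in_pvar) auto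
  then show ?thesis
    unfolding homogeneous_map_iff all_less_4 map_a_nth using map_a_carrier hom by auto
qed

lemma homogeneous_map_b:
  assumes "d \<ge> 2"
  shows "homogeneous_map 5 d (map_b d :: 'a::comm_ring_1 mpoly vec)"
proof -
  have hom: "homogeneous d (pvar i ^ (d - 1) * pvar j :: 'a mpoly)" for i j
    using homogeneous_mult[OF homogeneous_power[OF homogeneous_pvar, of "d - 1" i] homogeneous_pvar[of j],
        where 'a = 'a] assms by simp
  have "poly_in 5 (pvar i ^ (d - 1) * pvar j :: 'a mpoly)" if "i < 5" "j < 5" for i j
    using that by (intro poly_in_mult poly_in_power poly_in_pvar) auto
  then show ?thesis
    unfolding homogeneous_map_iff all_less_5 map_b_nth using map_b_carrier hom
    by (auto intro!: homogeneous_diff poly_in_diff)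
qed

section \<open>The map in dimension 4: invertible, but with a singular Jacobian sum\<close>

lemma JC_minus_map_a: "JC_minus 4 (id_map 4 + (map_a d :: 'a::comm_ring_1 mpoly vec))"
proof -
  let ?H = "map_a d :: 'a mpoly vec"
  note pc = comm_ring_hom_pconst[where 'a = 'a]
  interpret pc: comm_ring_hom "pconst :: 'a \<Rightarrow> 'a mpoly" by (rule pc)
  interpret ev: comm_ring_hom "psubst pconst v" for v :: "'a mpoly vec" by (rule comm_ring_hom_psubst[OF pc])
  \<comment> \<open>The scalar \<open>e\<close> treats \<open>x + H\<close> and \<open>x - H\<close>
    together, as \<open>e = 1\<close> and \<open>e = - 1\<close>.\<close>
  have invariant: "psubst pconst V (?H $ i) = ?H $ i"
    if "V $ 0 = pvar 0" "V $ Suc 0 = pvar 1" "V $ 2 = pvar 2 + pconst e * ?H $ 2" "V $ 3 = pvar 3 + pconst e * ?H $ 3"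
      "i < 4" for V :: "'a mpoly vec" and i e
  proof -
    \<comment> \<open>The two increments cancel, since
      \<open>pvar 0 * ?H $ 2 = pvar 1 * ?H $ 3\<close>.\<close>
    have q: "pvar 0 * (pvar 2 + pconst e * ?H $ 2) - pvar 1 * (pvar 3 + pconst e * ?H $ 3) =
        pvar 0 * pvar 2 - pvar 1 * pvar 3"
      by (simp add: map_a_nth algebra_simps)
    have "\<forall>i<4. psubst pconst V (?H $ i) = ?H $ i"
      unfolding all_less_4 using that(1-4) q
      by (simp add: map_a_nth(2,3)) (simp add: map_a_nth(4,5)[of d] ev.hom_mult ev.hom_minus ev.hom_power psubst_pvar[OF pc])
    with that(5) show ?thesis by blast
  qed
  have dims [simp]: "dim_vec ?H = 4" "dim_vec (id_map 4 :: 'a mpoly vec) = 4"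
    by (simp_all add: map_a_nth id_map_def)
  have plus: "psubst pconst (id_map 4 + ?H) (?H $ i) = ?H $ i" if "i < 4" for i
    using that by (intro invariant[where e = 1]) (simp_all add: id_map_def map_a_nth(2,3))
  have minus: "psubst pconst (id_map 4 - ?H) (?H $ i) = ?H $ i" if "i < 4" for i
    using that by (intro invariant[where e = "- 1"]) (simp_all add: id_map_def map_a_nth(2,3) pc.hom_uminus)
  have "compose_map (id_map 4 + ?H) (id_map 4 - ?H) = id_map 4"
    by (intro eq_vecI) (simp_all add: compose_map_def id_map_def ev.hom_add psubst_pvar[OF pc] minus[unfolded id_map_def])
  moreover have "compose_map (id_map 4 - ?H) (id_map 4 + ?H) = id_map 4"
    by (intro eq_vecI) (simp_all add: compose_map_def id_map_def ev.hom_minus psubst_pvar[OF pc] plus[unfolded id_map_def])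
  moreover have "id_map 4 - ?H \<in> poly_maps 4"
  proof -
    have "poly_in 4 (?H $ i)" if "i < 4" for i
    proof -
      have "\<forall>i<4. poly_in 4 (?H $ i)"
        unfolding all_less_4 map_a_nth by (intro conjI poly_in_mult poly_in_power poly_in_diff poly_in_pvar) auto
      with that show ?thesis by blast
    qed
    then show ?thesis
      using map_a_carrier[of d, where 'a = 'a]
      by (auto simp: poly_maps_iff id_map_def intro!: poly_in_diff)
  qed
  ultimately show ?thesis unfolding JC_minus_def by blast
qed

lemma not_JC_map_a:
  assumes d: "d \<ge> 3"
  shows "\<not> JC 4 d (id_map 4 + (map_a d :: 'a::field_char_0 mpoly vec))"
proof -
  note to_ac = comm_ring_hom_to_ac[where 'a = 'a]
  interpret ev: comm_ring_hom "psubst to_ac v" for v :: "'a alg_closure vec"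
    by (rule comm_ring_hom_psubst[OF to_ac])
  let ?r = "of_nat (d - 1) :: 'a alg_closure"
  \<comment> \<open>On the last two coordinates the Jacobian sum is the matrix with rows
    \<open>(r + u ^ 2 * 0 + u, - u ^ 2)\<close> and \<open>(2, r - u)\<close>, where
    \<open>r = d - 1\<close>. Its determinant is \<open>r ^ 2 + u ^ 2\<close>, and
    \<open>(u - r, 2)\<close> annihilates the second row.\<close>
  obtain u :: "'a alg_closure" where u: "u ^ 2 = - (?r ^ 2)"
    using nth_root_exists[of 2 "- (?r ^ 2)"] by auto
  define w where "w = vec_of_list [0, 0, u - ?r, 2 :: 'a alg_closure]"
  define v where "v k = (if k = 1 then vec_of_list [1, 0, 0, 0] else
    if k = 2 then vec_of_list [1, u, 0, 0] else (0\<^sub>v 4 :: 'a alg_closure vec))" for k :: nat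
  have w_nth: "w $ 0 = 0" "w $ Suc 0 = 0" "w $ 2 = u - ?r" "w $ 3 = 2" "w \<in> carrier_vec 4"
    by (simp_all add: w_def vec_of_list_index carrier_vecI del: vec_of_list_Cons vec_of_list_Nil)
  have v_carrier: "v k \<in> carrier_vec 4" for k
    by (auto simp: v_def intro!: carrier_vecI)
  have v_nth: "v 1 $ 0 = 1" "v 1 $ Suc 0 = 0" "v 2 $ 0 = 1" "v 2 $ Suc 0 = u"
    by (simp_all add: v_def vec_of_list_index del: vec_of_list_Cons vec_of_list_Nil)
  have D: "dir_deriv 4 to_ac z w (map_a d $ 2) = z $ 0 ^ (d - 3) * z $ Suc 0 * (z $ 0 * w $ 2 - z $ Suc 0 * w $ 3)"
    "dir_deriv 4 to_ac z w (map_a d $ 3) = z $ 0 ^ (d - 3) * z $ 0 * (z $ 0 * w $ 2 - z $ Suc 0 * w $ 3)"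
    for z
    unfolding map_a_nth
    by (simp_all add: dir_deriv_mult[OF to_ac] dir_deriv_diff[OF to_ac] dir_deriv_power[OF to_ac]
        dir_deriv_pvar[OF to_ac] psubst_pvar[OF to_ac] w_nth(1,2) ev.hom_minus ev.hom_mult ev.hom_power algebra_simps)
  \<comment> \<open>Since \<open>d \<ge> 3\<close>, both special points are among the
    \<open>d - 1\<close> points; the others are the origin, where these derivatives vanish.\<close>
  have sum_split: "(\<Sum>k = 1..d - 1. dir_deriv 4 to_ac (v k) w (map_a d $ i)) =
      dir_deriv 4 to_ac (v 1) w (map_a d $ i) + dir_deriv 4 to_ac (v 2) w (map_a d $ i)" if "i = 2 \<or> i = 3" for i
  proof -
    have "(\<Sum>k = 1..d - 1. dir_deriv 4 to_ac (v k) w (map_a d $ i)) =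
        (\<Sum>k \<in> {1, 2}. dir_deriv 4 to_ac (v k) w (map_a d $ i))"
    proof (rule sum.mono_neutral_right)
      show "\<forall>k\<in>{1..d - 1} - {1, 2}. dir_deriv 4 to_ac (v k) w (map_a d $ i) = 0"
        using that by (auto simp: D v_def)
    qed (use d in auto)
    then show ?thesis by simp
  qed
  have "\<forall>i<4. ?r * w $ i + (\<Sum>k = 1..d - 1. dir_deriv 4 to_ac (v k) w (map_a d $ i)) = 0"
    unfolding all_less_4
  proof (intro conjI)
    show "?r * w $ 2 + (\<Sum>k = 1..d - 1. dir_deriv 4 to_ac (v k) w (map_a d $ 2)) = 0"
      using u unfolding sum_split[OF disjI1[OF refl]] unfolding D v_nth w_nth
      by (simp add: algebra_simps power2_eq_square)
    show "?r * w $ 3 + (\<Sum>k = 1..d - 1. dir_deriv 4 to_ac (v k) w (map_a d $ 3)) = 0"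
      unfolding sum_split[OF disjI2[OF refl]] unfolding D v_nth w_nth by (simp add: algebra_simps)
  qed (simp_all add: w_nth map_a_nth dir_deriv_0[OF to_ac])
  moreover have "w \<noteq> 0\<^sub>v 4"
    using w_nth(4) by auto
  ultimately show ?thesis
    unfolding JC_def jacobian_sums_nonsingular_iff_kernel[OF map_a_carrier]
    using v_carrier w_nth(5) by blast
qed

lemma map_value_map_a:
  "map_value (map_a d :: 'a::comm_ring_1 mpoly vec) (vec_of_list [1, 1, 1, 0]) \<noteq> 0\<^sub>v 4"
proof -
  note id = comm_ring_hom_id[where 'a = 'a]
  interpret ev: comm_ring_hom "psubst (\<lambda>x. x) v" for v :: "'a vec" by (rule comm_ring_hom_psubst[OF id])
  have "map_value (map_a d :: 'a mpoly vec) (vec_of_list [1, 1, 1, 0]) $ 2 = 1"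
    by (simp add: map_value_def map_a_nth ev.hom_mult ev.hom_minus ev.hom_power psubst_pvar[OF id] vec_of_list_index
        del: vec_of_list_Cons vec_of_list_Nil)
  then show ?thesis by auto
qed

section \<open>The map in dimension 5: nonsingular Jacobian sums, but a cycle of increments\<close>

lemma jacobian_sums_nonsingular_map_b:
  assumes r: "r > 0"
  shows "jacobian_sums_nonsingular r 5 (id_map 5 + (map_b d :: 'a::field_char_0 mpoly vec))"
  unfolding jacobian_sums_nonsingular_iff_kernel[OF map_b_carrier]
proof (intro allI impI ballI)
  note to_ac = comm_ring_hom_to_ac[where 'a = 'a]
  interpret ev: comm_ring_hom "psubst to_ac v" for v :: "'a alg_closure vec"
    by (rule comm_ring_hom_psubst[OF to_ac])
  fix v :: "nat \<Rightarrow> 'a alg_closure vec" and w :: "'a alg_closure vec"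
  assume w: "w \<in> carrier_vec 5"
    and ker: "\<forall>i<5. of_nat r * w $ i + (\<Sum>k = 1..r. dir_deriv 5 to_ac (v k) w (map_b d $ i)) = 0"
  let ?r = "of_nat r :: 'a alg_closure"
  \<comment> \<open>As \<open>w\<close> vanishes in the first two coordinates, the points enter only
    through the sums \<open>S\<close> and \<open>T\<close>, whatever their number.\<close>
  define S where "S = (\<Sum>k = 1..r. v k $ 0 ^ (d - 1))"
  define T where "T = (\<Sum>k = 1..r. v k $ Suc 0 ^ (d - 1))"
  have r0: "?r \<noteq> 0" using r by simp
  have w01: "w $ 0 = 0" "w $ Suc 0 = 0"
    using ker r0 unfolding all_less_5 by (auto simp: map_b_nth dir_deriv_0[OF to_ac])
  have D: "dir_deriv 5 to_ac z w (pvar 0 ^ (d - Suc 0) * pvar j) = z $ 0 ^ (d - Suc 0) * w $ j"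
    "dir_deriv 5 to_ac z w (pvar (Suc 0) ^ (d - Suc 0) * pvar j) = z $ Suc 0 ^ (d - Suc 0) * w $ j" if "j < 5" for z j
    using that by (simp_all add: dir_deriv_mult[OF to_ac] dir_deriv_power[OF to_ac] dir_deriv_pvar[OF to_ac]
        psubst_pvar[OF to_ac] w01 ev.hom_power)
  have "?r * w $ 2 + T * w $ 3 = 0" "?r * w $ 3 + (S * w $ 2 - T * w $ 4) = 0" "?r * w $ 4 + S * w $ 3 = 0"
    using ker unfolding all_less_5 map_b_nth
    by (simp_all add: D dir_deriv_diff[OF to_ac] sum_subtractf S_def T_def sum_distrib_right)
  then have eqs: "?r * w $ 2 = - (T * w $ 3)" "?r * w $ 3 = T * w $ 4 - S * w $ 2" "?r * w $ 4 = - (S * w $ 3)"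
    by (simp_all add: eq_neg_iff_add_eq_0 algebra_simps)
  \<comment> \<open>Eliminating \<open>w $ 2\<close> and \<open>w $ 4\<close> yields
    \<open>- T * S * w $ 3 + S * T * w $ 3\<close>, which is nilpotency at work.\<close>
  have "?r * (?r * w $ 3) = T * (?r * w $ 4) - S * (?r * w $ 2)"
    unfolding eqs(2) by (simp add: algebra_simps)
  also have "\<dots> = 0"
    unfolding eqs(1,3) by (simp add: algebra_simps)
  finally have w3: "w $ 3 = 0" using r0 by simp
  then have "w $ 2 = 0" "w $ 4 = 0" using eqs(1,3) r0 by auto
  with w01 w3 have "\<forall>i<5. w $ i = 0" unfolding all_less_5 by simp
  then show "w = 0\<^sub>v 5" using w by auto
qed

text \<open>The base points switch on one coefficient each: the first makes
  \<open>pvar 0 ^ (d - 1)\<close> equal to 1, the second \<open>pvar 1 ^ (d - 1)\<close>. In the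
  second equation \<open>d \<ge> 2\<close> makes the last component vanish.\<close>

lemma map_b_cycle:
  assumes "d \<ge> 2"
  shows "map_value (map_b d :: 'a::comm_ring_1 mpoly vec) (unit_vec 5 0 + unit_vec 5 2) - map_value (map_b d) (unit_vec 5 0)
      = unit_vec 5 3"
    and "map_value (map_b d :: 'a::comm_ring_1 mpoly vec) (unit_vec 5 1 + unit_vec 5 3) - map_value (map_b d) (unit_vec 5 1)
      = unit_vec 5 2"
proof -
  note id = comm_ring_hom_id[where 'a = 'a]
  interpret ev: comm_ring_hom "psubst (\<lambda>x. x) v" for v :: "'a vec" by (rule comm_ring_hom_psubst[OF id])
  have eq: "x = y" if "dim_vec x = 5" "dim_vec y = 5" "\<forall>i<5. x $ i = y $ i" for x y :: "'a vec"
    using that by auto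
  note simps = map_value_def map_b_nth ev.hom_mult ev.hom_minus ev.hom_power ev.hom_zero psubst_pvar[OF id]
  show "map_value (map_b d :: 'a mpoly vec) (unit_vec 5 0 + unit_vec 5 2) - map_value (map_b d) (unit_vec 5 0)
      = unit_vec 5 3"
    using assms by (intro eq) (simp_all add: all_less_5 simps power_0_left)
  show "map_value (map_b d :: 'a mpoly vec) (unit_vec 5 1 + unit_vec 5 3) - map_value (map_b d) (unit_vec 5 1)
      = unit_vec 5 2"
    using assms by (intro eq) (simp_all add: all_less_5 simps power_0_left)
qed

lemma map_value_map_b:
  assumes "d \<ge> 2"
  shows "map_value (map_b d :: 'a::comm_ring_1 mpoly vec) (unit_vec 5 1 + unit_vec 5 3) \<noteq> 0\<^sub>v 5"
proof -
  note id = comm_ring_hom_id[where 'a = 'a]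
  interpret ev: comm_ring_hom "psubst (\<lambda>x. x) v" for v :: "'a vec" by (rule comm_ring_hom_psubst[OF id])
  have "map_value (map_b d :: 'a mpoly vec) (unit_vec 5 1 + unit_vec 5 3) $ 2 = 1"
    by (simp add: map_value_def map_b_nth ev.hom_mult ev.hom_power psubst_pvar[OF id])
  then show ?thesis by auto
qed

lemma map_b_not_star:
  assumes "d \<ge> 2"
  shows "\<not> star_property 5 d (map_b d :: 'a::comm_ring_1 mpoly vec)"
proof
  assume "star_property 5 d (map_b d :: 'a mpoly vec)"
  then have "unit_vec 5 3 = (0\<^sub>v 5 :: 'a vec)"
    by (rule star_property_no_cycle[OF _ _ _ _ _ map_b_cycle[OF assms]]) auto
  then show False using unit_vec_nonzero[of 3 5, where 'a = 'a] by simp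
qed

section \<open>The power linear counterexamples and the theorem\<close>

lemma power_linear_minus_not_JC:
  assumes d: "d \<ge> 3"
  shows "\<exists>n. \<exists>H :: 'a::field_char_0 mpoly vec. power_linear n d H \<and> map_degree (id_map n + H) = d \<and>
    JC_minus n (id_map n + H) \<and> \<not> JC n d (id_map n + H)"
proof -
  obtain N and b c :: "nat \<Rightarrow> 'a vec" and s where "power_sum_map 4 N d b c s (map_a d)"
    using homogeneous_map_pairing[OF homogeneous_map_a[OF d]] d by (metis gr_zeroI not_numeral_le_zero)
  then interpret power_sum_map 4 N d b c s "map_a d" .
  \<comment> \<open>The pairing changes the dimension but not the degree, so the same number
    \<open>d - 1\<close> of points is used.\<close>
  have "\<not> JC N d (id_map N + P)"
    using jacobian_sums_singular_P[OF not_JC_map_a[OF d, unfolded JC_def]] d by (simp add: JC_def)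
  moreover have "map_degree (id_map N + P) = d"
    using d by (intro map_degree_P[OF _ _ map_value_map_a]) (auto intro: carrier_vecI)
  ultimately show ?thesis
    using power_linear_P JC_minus_P[OF JC_minus_map_a] by blast
qed

lemma power_linear_plus_not_star:
  assumes d: "d \<ge> 2"
  shows "\<exists>n. \<exists>H :: 'a::field_char_0 mpoly vec. power_linear n d H \<and> map_degree (id_map n + H) = d \<and>
    JC_plus n (id_map n + H) \<and> \<not> star_property n d H"
proof -
  obtain N and b c :: "nat \<Rightarrow> 'a vec" and s where "power_sum_map 5 N d b c s (map_b d)"
    using homogeneous_map_pairing[OF homogeneous_map_b[OF d]] d by (metis gr_zeroI not_numeral_le_zero)
  then interpret power_sum_map 5 N d b c s "map_b d" .
  \<comment> \<open>Here the number of points is the new dimension \<open>N\<close>, so the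
    nonsingularity for \<open>map_b d\<close> is applied with \<open>r = N\<close>, which must be
    positive.\<close>
  have "N > 0" using s[of 0] by simp
  then have "JC_plus N (id_map N + P)"
    unfolding JC_plus_def by (intro jacobian_sums_nonsingular_P jacobian_sums_nonsingular_map_b)
  moreover have "\<not> star_property N d P"
    by (rule not_star_property_P[OF _ _ _ _ map_b_cycle[OF d]]) (auto simp: unit_vec_nonzero)
  moreover have "map_degree (id_map N + P) = d"
    using d by (intro map_degree_P[OF _ _ map_value_map_b]) auto
  ultimately show ?thesis
    using power_linear_P by blast
qed

theorem theorem5p1:
  shows
    "(\<forall>d\<ge>3.
        let x1 = pvar 0; x2 = pvar 1; x3 = pvar 2; x4 = pvar 3;
            H = (x1 ^ (d - 3) \<cdot>\<^sub>v vec_of_list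
                  [0, 0, x2 * (x1 * x3 - x2 * x4), x1 * (x1 * x3 - x2 * x4)]
                  :: 'a::field_char_0 mpoly vec);
            F = id_map 4 + H
        in homogeneous_map 4 d H \<and> map_degree F = d \<and> JC_minus 4 F \<and> \<not> JC 4 d F)
     \<and>
     (\<forall>d\<ge>2.
        let x1 = pvar 0; x2 = pvar 1; x3 = pvar 2; x4 = pvar 3; x5 = pvar 4;
            H = (vec_of_list
                  [0, 0, x2 ^ (d - 1) * x4,
                   x1 ^ (d - 1) * x3 - x2 ^ (d - 1) * x5, x1 ^ (d - 1) * x4]
                  :: 'a mpoly vec);
            F = id_map 5 + H
        in homogeneous_map 5 d H \<and> map_degree F = d \<and> JC_plus 5 F \<and> \<not> star_property 5 d H)
     \<and>
     (\<forall>d\<ge>3. \<exists>n. \<exists>H :: 'a mpoly vec.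
        power_linear n d H \<and> map_degree (id_map n + H) = d \<and>
        JC_minus n (id_map n + H) \<and> \<not> JC n d (id_map n + H))
     \<and>
     (\<forall>d\<ge>2. \<exists>n. \<exists>H :: 'a mpoly vec.
        power_linear n d H \<and> map_degree (id_map n + H) = d \<and>
        JC_plus n (id_map n + H) \<and> \<not> star_property n d H)"
  unfolding Let_def map_a_def[symmetric] map_b_def[symmetric]
proof (intro conjI allI impI)
  fix d :: nat assume d: "d \<ge> 3"
  show "homogeneous_map 4 d (map_a d :: 'a mpoly vec)" by (rule homogeneous_map_a[OF d])
  then show "map_degree (id_map 4 + (map_a d :: 'a mpoly vec)) = d"
    using d by (intro map_degree_id_plus_map_value[OF _ _ map_value_map_a]) auto
  show "JC_minus 4 (id_map 4 + (map_a d :: 'a mpoly vec))" by (rule JC_minus_map_a)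
  show "\<not> JC 4 d (id_map 4 + (map_a d :: 'a mpoly vec))" by (rule not_JC_map_a[OF d])
next
  fix d :: nat assume d: "d \<ge> 2"
  show "homogeneous_map 5 d (map_b d :: 'a mpoly vec)" by (rule homogeneous_map_b[OF d])
  then show "map_degree (id_map 5 + (map_b d :: 'a mpoly vec)) = d"
    using d by (intro map_degree_id_plus_map_value[OF _ _ map_value_map_b]) auto
  show "JC_plus 5 (id_map 5 + (map_b d :: 'a mpoly vec))"
    unfolding JC_plus_def by (rule jacobian_sums_nonsingular_map_b) simp
  show "\<not> star_property 5 d (map_b d :: 'a mpoly vec)" by (rule map_b_not_star[OF d])
qed (rule power_linear_minus_not_JC power_linear_plus_not_star; assumption)+

end
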